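(* Let $\Psi$ be a Turing functional. There is a computable coloring $c:[\omega]^2\to 2$ such that for every $k\geq 2$, every stable coloring $d:[\omega]^2\to k$ has an infinite limit-homogeneous set $L$ with the property that $\Psi^L$ is not equal to (the characteristic function of) any infinite homogeneous set for $c$.
   Context: $[X]^2$ is the set of two-element subsets of $X$, and $k=\{0,\ldots,k-1\}$. A coloring $d:[\omega]^2\to k$ is stable if for every $x$ the limit $\lim_y d(x,y)$ exists. A set $H$ is homogeneous for $c$ if $c$ is constant on $[H]^2$. A set $L$ is limit-homogeneous for a stable coloring $d$ if there is $j<k$ with $\lim_y d(x,y)=j$ for all $x\in L$. *)

theory Defs
  imports Complex_Main "HOL-Library.Ramsey"
begin

section \<open>Computation relative to an oracle\<close>

text \<open>
  Kleene's partial recursive functions relative to an oracle \<open>X\<close>, presented by programs: the basic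
  functions together with the characteristic function of \<open>X\<close>, closed under composition, primitive
  recursion and unbounded minimisation.  Arguments are passed as lists; a program applied to a list
  of the wrong length may be undefined.
\<close>

datatype prog =
    Zero
  | Succ
  | Proj nat
  | Oracle
  | Comp prog "prog list"
  | PrimRec prog prog
  | Mu prog

definition char_fun :: "nat set \<Rightarrow> nat \<Rightarrow> nat" where
  "char_fun X n = (if n \<in> X then 1 else 0)"

text \<open>
  In \<open>PrimRec f g\<close> the recursion variable is the first argument and \<open>g\<close> receives the predecessor,
  the previous value and the parameters, in this order.  As usual, \<open>Mu f\<close> converges to \<open>n\<close> on \<open>xs\<close>
  only if \<open>f\<close> converges on \<open>m # xs\<close> for all \<open>m \<le> n\<close>; hence the predicate below has at most one
  witness.
\<close>

primrec run :: "prog \<Rightarrow> nat set \<Rightarrow> nat list \<Rightarrow> nat option" where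
  "run Zero X xs = Some 0"
| "run Succ X xs = (case xs of [x] \<Rightarrow> Some (Suc x) | _ \<Rightarrow> None)"
| "run (Proj i) X xs = (if i < length xs then Some (xs ! i) else None)"
| "run Oracle X xs = (case xs of [x] \<Rightarrow> Some (char_fun X x) | _ \<Rightarrow> None)"
| "run (Comp f gs) X xs =
     Option.bind (those (map (\<lambda>g. run g X xs) gs)) (\<lambda>ys. run f X ys)"
| "run (PrimRec f g) X xs =
     (case xs of
        [] \<Rightarrow> None
      | n # ys \<Rightarrow>
          rec_nat (run f X ys) (\<lambda>m r. Option.bind r (\<lambda>y. run g X (m # y # ys))) n)"
| "run (Mu f) X xs =
     (if \<exists>n. run f X (n # xs) = Some 0 \<and> (\<forall>m<n. \<exists>y. run f X (m # xs) = Some (Suc y))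
      then Some (THE n. run f X (n # xs) = Some 0 \<and>
                        (\<forall>m<n. \<exists>y. run f X (m # xs) = Some (Suc y)))
      else None)"

text \<open>\<open>\<Psi> X n = None\<close> means that \<open>\<Psi>\<close> with oracle \<open>X\<close> diverges on input \<open>n\<close>.\<close>

definition turing_functional :: "(nat set \<Rightarrow> nat \<Rightarrow> nat option) \<Rightarrow> bool" where
  "turing_functional \<Psi> \<longleftrightarrow> (\<exists>p. \<forall>X n. \<Psi> X n = run p X [n])"


section \<open>Colorings of pairs\<close>

text \<open>
  A coloring of \<open>[\<omega>]\<^sup>2\<close> is a function on sets of naturals, of which only the values on
  two-element sets matter; \<open>d(x, y)\<close> is \<open>d {x, y}\<close>.
\<close>

definition coloring :: "nat \<Rightarrow> (nat set \<Rightarrow> nat) \<Rightarrow> bool" where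
  "coloring k d \<longleftrightarrow> d \<in> nsets UNIV 2 \<rightarrow> {..<k}"

text \<open>Unordered pairs are presented to the program in increasing order; the oracle is empty.\<close>

definition computable_coloring :: "(nat set \<Rightarrow> nat) \<Rightarrow> bool" where
  "computable_coloring d \<longleftrightarrow> (\<exists>p. \<forall>x y. x < y \<longrightarrow> run p {} [x, y] = Some (d {x, y}))"

text \<open>
  Limits are taken in the discrete topology of \<^typ>\<open>nat\<close>, so convergence means being eventually
  constant; the value of \<open>d\<close> on the degenerate pair with \<open>y = x\<close> is irrelevant for it.
\<close>

definition stable_coloring :: "nat \<Rightarrow> (nat set \<Rightarrow> nat) \<Rightarrow> bool" where
  "stable_coloring k d \<longleftrightarrow> coloring k d \<and> (\<forall>x. \<exists>j. (\<lambda>y. d {x, y}) \<longlonglongrightarrow> j)"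

definition homogeneous :: "(nat set \<Rightarrow> nat) \<Rightarrow> nat set \<Rightarrow> bool" where
  "homogeneous c H \<longleftrightarrow> (\<exists>i. \<forall>e \<in> nsets H 2. c e = i)"

definition limit_homogeneous :: "nat \<Rightarrow> (nat set \<Rightarrow> nat) \<Rightarrow> nat set \<Rightarrow> bool" where
  "limit_homogeneous k d L \<longleftrightarrow> (\<exists>j<k. \<forall>x\<in>L. (\<lambda>y. d {x, y}) \<longlonglongrightarrow> j)"

end

theory Submission
  imports Defs "HOL-Library.Nat_Bijection"
begin

text \<open>
  If every infinite set \<open>Y\<close> has an infinite subset \<open>L\<close> for which \<open>\<Psi>\<^sup>L\<close> is not an infinite set, then
  such an \<open>L\<close> exists inside an infinite limit color class of \<open>d\<close> and any coloring \<open>c\<close> works.  So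
  suppose that \<open>\<Psi>\<^sup>L\<close> is an infinite set for every infinite subset \<open>L\<close> of a fixed infinite set \<open>Y\<close>.
  Then every finite part of a coloring \<open>c\<close> can be extended to a finite part such that every partition
  of \<open>[s, \<infinity>)\<close> into \<open>k\<close> classes has a class with a finite subset \<open>E\<close> for which \<open>\<Psi>\<^sup>E\<close> visibly contains
  two pairs of different colors.  Such an extension can be recognised from finitely much information,
  so it can be found by a blind search that makes no reference to \<open>Y\<close>.  Performing the search for
  \<open>k = 1, 2, 3, \<dots>\<close> in turn yields a computable \<open>c\<close>; the finite limit color classes of a given \<open>d\<close> lie
  below some stage \<open>s\<close>, so that \<open>E\<close> extends to an infinite limit-homogeneous set \<open>L\<close>.
\<close>

section \<open>Functions computable without an oracle\<close>

text \<open>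
  The arguments are \<open>e 0, \<dots>, e (n - 1)\<close>.  Reading them off a function rather than a list lets the
  closure rules below be applied by higher-order pattern unification: binding a variable shifts \<open>e\<close>.
\<close>

definition recf :: "nat \<Rightarrow> ((nat \<Rightarrow> nat) \<Rightarrow> nat) \<Rightarrow> bool" where
  "recf n f \<longleftrightarrow> (\<exists>q. \<forall>e. run q {} (map e [0..<n]) = Some (f e))"

definition recp :: "nat \<Rightarrow> ((nat \<Rightarrow> nat) \<Rightarrow> bool) \<Rightarrow> bool" where
  "recp n P \<longleftrightarrow> recf n (\<lambda>e. of_bool (P e))"

section \<open>Composition and primitive recursion\<close>

lemma those_map_Some: "those (map (\<lambda>x. Some (f x)) xs) = Some (map f xs)"
  by (induction xs) auto

lemma recf_var: "i < n \<Longrightarrow> recf n (\<lambda>e. e i)"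
  unfolding recf_def by (rule exI[of _ "Proj i"]) simp

lemma recf_subst:
  assumes h: "recf m h" and f: "\<And>i. i < m \<Longrightarrow> recf n (f i)"
  shows "recf n (\<lambda>e. h (\<lambda>i. f i e))"
proof -
  obtain q where q: "\<And>e. run q {} (map e [0..<m]) = Some (h e)"
    using h unfolding recf_def by blast
  have "\<forall>i. \<exists>r. i < m \<longrightarrow> (\<forall>e. run r {} (map e [0..<n]) = Some (f i e))"
    using f unfolding recf_def by blast
  then obtain r where r: "\<And>i e. i < m \<Longrightarrow> run (r i) {} (map e [0..<n]) = Some (f i e)"
    by metis
  have "run (Comp q (map r [0..<m])) {} (map e [0..<n]) = Some (h (\<lambda>i. f i e))" for e
  proof -
    have "map (\<lambda>g. run g {} (map e [0..<n])) (map r [0..<m]) = map (\<lambda>i. Some (f i e)) [0..<m]"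
      using r by simp
    then show ?thesis
      using q[of "\<lambda>i. f i e"] by (simp only: run.simps those_map_Some bind.bind_lunit)
  qed
  then show ?thesis
    unfolding recf_def by blast
qed

text \<open>With this and its binary and ternary analogues, a function is shown computable once, in
  its own variables, and then applied to arbitrary computable arguments.\<close>

lemma recf_subst1: "recf 1 (\<lambda>e. h (e 0)) \<Longrightarrow> recf n f \<Longrightarrow> recf n (\<lambda>e. h (f e))"
  using recf_subst[of 1 "\<lambda>e. h (e 0)" n "\<lambda>_. f"] by simp

lemma recf_subst2:
  "recf 2 (\<lambda>e. h (e 0) (e (Suc 0))) \<Longrightarrow> recf n f \<Longrightarrow> recf n g \<Longrightarrow> recf n (\<lambda>e. h (f e) (g e))"
  using recf_subst[of 2 "\<lambda>e. h (e 0) (e (Suc 0))" n "\<lambda>i. if i = 0 then f else g"] by simp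

lemma recf_subst3:
  "recf 3 (\<lambda>e. h (e 0) (e (Suc 0)) (e (Suc (Suc 0)))) \<Longrightarrow> recf n f \<Longrightarrow> recf n g \<Longrightarrow> recf n k
    \<Longrightarrow> recf n (\<lambda>e. h (f e) (g e) (k e))"
  using recf_subst[of 3 "\<lambda>e. h (e 0) (e (Suc 0)) (e (Suc (Suc 0)))" n
      "\<lambda>i. if i = 0 then f else if i = 1 then g else k"] by simp

lemma recf_Suc: "recf n f \<Longrightarrow> recf n (\<lambda>e. Suc (f e))"
proof -
  have "run (Comp Succ [Proj 0]) {} (map e [0..<1]) = Some (Suc (e 0))" for e
    by simp
  then have "recf 1 (\<lambda>e. Suc (e 0))"
    unfolding recf_def by blast
  then show "recf n f \<Longrightarrow> recf n (\<lambda>e. Suc (f e))"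
    by (rule recf_subst1[where h = Suc])
qed

lemma recf_const: "recf n (\<lambda>e. c)"
proof (induction c)
  case 0
  have "run Zero {} (map e [0..<n]) = Some 0" for e :: "nat \<Rightarrow> nat"
    by simp
  then show ?case
    unfolding recf_def by blast
next
  case (Suc c)
  then show ?case
    by (rule recf_Suc)
qed

text \<open>\<open>PrimRec\<close> recurses on its first argument, whereas here the number of steps
  is itself a computable function \<open>b\<close>. So the recursion is first programmed on a fresh
  leading argument, with the parameters shifted by one, and \<open>b\<close> is then substituted for
  that argument.\<close>

lemma recf_rec_nat:
  assumes f: "recf n f" and g: "recf (Suc (Suc n)) (\<lambda>e. g (e 0) (e (Suc 0)) (\<lambda>i. e (Suc (Suc i))))"
    and b: "recf n b"
  shows "recf n (\<lambda>e. rec_nat (f e) (\<lambda>m r. g m r e) (b e))"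
proof -
  obtain p where p: "\<And>e. run p {} (map e [0..<n]) = Some (f e)"
    using f unfolding recf_def by blast
  obtain q where q: "\<And>e. run q {} (map e [0..<Suc (Suc n)])
      = Some (g (e 0) (e (Suc 0)) (\<lambda>i. e (Suc (Suc i))))"
    using g unfolding recf_def by blast
  have q': "run q {} (m # r # map e [0..<n]) = Some (g m r e)" for m r e
    using q[of "\<lambda>i. case i of 0 \<Rightarrow> m | Suc i \<Rightarrow> (case i of 0 \<Rightarrow> r | Suc i \<Rightarrow> e i)"]
    by (simp add: map_upt_Suc del: upt_Suc)
  have "rec_nat (Some (f e)) (\<lambda>m r. Option.bind r (\<lambda>y. run q {} (m # y # map e [0..<n]))) b
      = Some (rec_nat (f e) (\<lambda>m r. g m r e) b)" for e b
    by (induction b) (simp_all add: q')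
  then have "run (PrimRec p q) {} (map e [0..<Suc n])
      = Some (rec_nat (f (\<lambda>i. e (Suc i))) (\<lambda>m r. g m r (\<lambda>i. e (Suc i))) (e 0))" for e
    by (simp add: map_upt_Suc p del: upt_Suc)
  then have "recf (Suc n) (\<lambda>e. rec_nat (f (\<lambda>i. e (Suc i))) (\<lambda>m r. g m r (\<lambda>i. e (Suc i))) (e 0))"
    unfolding recf_def by blast
  then have "recf n (\<lambda>e. (\<lambda>e. rec_nat (f (\<lambda>i. e (Suc i))) (\<lambda>m r. g m r (\<lambda>i. e (Suc i))) (e 0))
      (\<lambda>i. (case i of 0 \<Rightarrow> b | Suc j \<Rightarrow> \<lambda>e. e j) e))"
    by (rule recf_subst[where f = "\<lambda>i. case i of 0 \<Rightarrow> b | Suc j \<Rightarrow> \<lambda>e. e j"])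
      (auto split: nat.split intro: b recf_var)
  then show ?thesis
    by simp
qed

section \<open>Primitive recursive arithmetic\<close>

lemma recf_add: "recf n f \<Longrightarrow> recf n g \<Longrightarrow> recf n (\<lambda>e. f e + g e)"
proof -
  have "recf 2 (\<lambda>e. rec_nat (e 0) (\<lambda>m r. Suc r) (e (Suc 0)))"
    by (intro recf_rec_nat recf_var recf_Suc) auto
  moreover have "rec_nat a (\<lambda>m r. Suc r) b = a + b" for a b
    by (induction b) auto
  ultimately have "recf 2 (\<lambda>e. e 0 + e (Suc 0))"
    by simp
  then show "recf n f \<Longrightarrow> recf n g \<Longrightarrow> recf n (\<lambda>e. f e + g e)"
    by (rule recf_subst2[where h = "(+)"])
qed

lemma recf_mult: "recf n f \<Longrightarrow> recf n g \<Longrightarrow> recf n (\<lambda>e. f e * g e)"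
proof -
  have "recf 2 (\<lambda>e. rec_nat 0 (\<lambda>m r. r + e 0) (e (Suc 0)))"
    by (intro recf_rec_nat recf_var recf_const recf_add) auto
  moreover have "rec_nat 0 (\<lambda>m r. r + a) b = a * b" for a b :: nat
    by (induction b) auto
  ultimately have "recf 2 (\<lambda>e. e 0 * e (Suc 0))"
    by simp
  then show "recf n f \<Longrightarrow> recf n g \<Longrightarrow> recf n (\<lambda>e. f e * g e)"
    by (rule recf_subst2[where h = "(*)"])
qed

lemma recf_power: "recf n f \<Longrightarrow> recf n g \<Longrightarrow> recf n (\<lambda>e. f e ^ g e)"
proof -
  have "recf 2 (\<lambda>e. rec_nat 1 (\<lambda>m r. e 0 * r) (e (Suc 0)))"
    by (intro recf_rec_nat recf_var recf_const recf_mult) auto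
  moreover have "rec_nat 1 (\<lambda>m r. a * r) b = a ^ b" for a b :: nat
    by (induction b) auto
  ultimately have "recf 2 (\<lambda>e. e 0 ^ e (Suc 0))"
    by simp
  then show "recf n f \<Longrightarrow> recf n g \<Longrightarrow> recf n (\<lambda>e. f e ^ g e)"
    by (rule recf_subst2[where h = "(^)"])
qed

lemma recf_diff: "recf n f \<Longrightarrow> recf n g \<Longrightarrow> recf n (\<lambda>e. f e - g e)"
proof -
  have "recf 1 (\<lambda>e. rec_nat 0 (\<lambda>m r. m) (e 0))"
    by (intro recf_rec_nat recf_var recf_const) auto
  moreover have "rec_nat 0 (\<lambda>m r. m) a = a - 1" for a
    by (cases a) auto
  ultimately have "recf 1 (\<lambda>e. e 0 - 1)"
    by simp
  then have pred: "recf n f \<Longrightarrow> recf n (\<lambda>e. f e - 1)" for n f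
    by (rule recf_subst1[where h = "\<lambda>x. x - 1"])
  have "recf 2 (\<lambda>e. rec_nat (e 0) (\<lambda>m r. r - 1) (e (Suc 0)))"
    by (intro recf_rec_nat recf_var pred) auto
  moreover have "rec_nat a (\<lambda>m r. r - 1) b = a - b" for a b :: nat
    by (induction b) auto
  ultimately have "recf 2 (\<lambda>e. e 0 - e (Suc 0))"
    by simp
  then show "recf n f \<Longrightarrow> recf n g \<Longrightarrow> recf n (\<lambda>e. f e - g e)"
    by (rule recf_subst2[where h = "(-)"])
qed

section \<open>Decidable predicates, bounded quantifiers and division\<close>

lemma recf_of_bool: "recp n P \<Longrightarrow> recf n (\<lambda>e. of_bool (P e))"
  by (simp add: recp_def)

lemma recp_not: "recp n P \<Longrightarrow> recp n (\<lambda>e. \<not> P e)"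
proof -
  assume "recp n P"
  then have "recf n (\<lambda>e. 1 - of_bool (P e))"
    unfolding recp_def by (intro recf_diff recf_const)
  moreover have "1 - of_bool p = (of_bool (\<not> p) :: nat)" for p
    by simp
  ultimately show ?thesis
    by (simp only: recp_def)
qed

lemma recp_conj: "recp n P \<Longrightarrow> recp n Q \<Longrightarrow> recp n (\<lambda>e. P e \<and> Q e)"
  unfolding recp_def of_bool_conj by (rule recf_mult)

lemma recp_disj: "recp n P \<Longrightarrow> recp n Q \<Longrightarrow> recp n (\<lambda>e. P e \<or> Q e)"
  using recp_not[OF recp_conj[OF recp_not[of n P] recp_not[of n Q]]] by simp

lemma recp_imp: "recp n P \<Longrightarrow> recp n Q \<Longrightarrow> recp n (\<lambda>e. P e \<longrightarrow> Q e)"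
  unfolding imp_conv_disj by (intro recp_disj recp_not)

lemma recp_iff: "recp n P \<Longrightarrow> recp n Q \<Longrightarrow> recp n (\<lambda>e. P e \<longleftrightarrow> Q e)"
  unfolding iff_conv_conj_imp by (intro recp_conj recp_imp)

lemma recp_le: "recf n f \<Longrightarrow> recf n g \<Longrightarrow> recp n (\<lambda>e. f e \<le> g e)"
proof -
  assume "recf n f" "recf n g"
  then have "recf n (\<lambda>e. 1 - (f e - g e))"
    by (intro recf_diff recf_const)
  moreover have "(1 - (a - b)) = of_bool (a \<le> b)" for a b :: nat
    by (auto simp: of_bool_def)
  ultimately show ?thesis
    by (simp add: recp_def)
qed

lemma recp_less: "recf n f \<Longrightarrow> recf n g \<Longrightarrow> recp n (\<lambda>e. f e < g e)"
  unfolding not_le[symmetric] by (intro recp_not recp_le)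

lemma recp_eq: "recf n f \<Longrightarrow> recf n g \<Longrightarrow> recp n (\<lambda>e. f e = g e)"
  unfolding eq_iff by (intro recp_conj recp_le)

lemma recf_If: "recp n P \<Longrightarrow> recf n f \<Longrightarrow> recf n g \<Longrightarrow> recf n (\<lambda>e. if P e then f e else g e)"
proof -
  assume "recp n P" "recf n f" "recf n g"
  then have "recf n (\<lambda>e. of_bool (P e) * f e + of_bool (\<not> P e) * g e)"
    by (intro recf_add recf_mult recf_of_bool recp_not)
  moreover have "of_bool p * a + of_bool (\<not> p) * b = (if p then a else b)" for p and a b :: nat
    by simp
  ultimately show ?thesis
    by simp
qed

lemma recf_sum:
  assumes "recf (Suc n) (\<lambda>e. g (e 0) (\<lambda>i. e (Suc i)))" "recf n b"
  shows "recf n (\<lambda>e. \<Sum>m<b e. g m e)"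
proof -
  \<comment> \<open>The step function of the recursion also receives the running sum, as its second
    argument; this substitution lets the summand skip it.\<close>
  have "recf (Suc (Suc n)) (\<lambda>e. (\<lambda>e. g (e 0) (\<lambda>i. e (Suc i)))
      (\<lambda>i. (case i of 0 \<Rightarrow> \<lambda>e. e 0 | Suc j \<Rightarrow> \<lambda>e. e (Suc (Suc j))) e))"
    by (rule recf_subst[OF assms(1), where f = "\<lambda>i. case i of 0 \<Rightarrow> \<lambda>e. e 0 | Suc j \<Rightarrow> \<lambda>e. e (Suc (Suc j))"])
      (auto split: nat.split intro: recf_var)
  then have "recf n (\<lambda>e. rec_nat 0 (\<lambda>m r. r + g m e) (b e))"
    by (intro recf_rec_nat recf_const recf_add recf_var assms(2)) auto
  moreover have "rec_nat 0 (\<lambda>m r. r + g m e) b = (\<Sum>m<b. g m e)" for b e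
    by (induction b) auto
  ultimately show ?thesis
    by simp
qed

lemma recp_ex:
  assumes "recp (Suc n) (\<lambda>e. P (e 0) (\<lambda>i. e (Suc i)))" "recf n b"
  shows "recp n (\<lambda>e. \<exists>m<b e. P m e)"
proof -
  have "recf n (\<lambda>e. \<Sum>m<b e. of_bool (P m e))"
    using assms unfolding recp_def by (rule recf_sum)
  then have "recp n (\<lambda>e. 0 < (\<Sum>m<b e. of_bool (P m e) :: nat))"
    by (intro recp_less recf_const)
  moreover have "0 < (\<Sum>m<b. of_bool (P m e) :: nat) \<longleftrightarrow> (\<exists>m<b. P m e)" for b e
    by (induction b) (auto simp: less_Suc_eq)
  ultimately show ?thesis
    by simp
qed

lemma recp_all:
  assumes "recp (Suc n) (\<lambda>e. P (e 0) (\<lambda>i. e (Suc i)))" "recf n b"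
  shows "recp n (\<lambda>e. \<forall>m<b e. P m e)"
proof -
  have "recp n (\<lambda>e. \<not> (\<exists>m<b e. \<not> P m e))"
    by (intro recp_not recp_ex assms)
  then show ?thesis
    by simp
qed

lemma recf_mod: "recf n f \<Longrightarrow> recf n g \<Longrightarrow> recf n (\<lambda>e. f e mod g e)"
proof -
  \<comment> \<open>The remainder is counted up and reset on reaching the divisor. For divisor 0 it
    is never reset, in accordance with \<open>a mod 0 = a\<close>.\<close>
  have "recf 2 (\<lambda>e. rec_nat 0 (\<lambda>m r. if Suc r = e (Suc 0) then 0 else Suc r) (e 0))"
    by (intro recf_rec_nat recf_var recf_const recf_Suc recf_If recp_eq) auto
  moreover have "rec_nat 0 (\<lambda>m r. if Suc r = b then 0 else Suc r) a = a mod b" for a b :: nat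
    by (induction a) (auto simp: mod_Suc)
  ultimately have "recf 2 (\<lambda>e. e 0 mod e (Suc 0))"
    by simp
  then show "recf n f \<Longrightarrow> recf n g \<Longrightarrow> recf n (\<lambda>e. f e mod g e)"
    by (rule recf_subst2[where h = "(mod)"])
qed

lemma recf_div: "recf n f \<Longrightarrow> recf n g \<Longrightarrow> recf n (\<lambda>e. f e div g e)"
proof -
  \<comment> \<open>The quotient counts the multiples of the divisor among 1, ..., a. For divisor 0
    there are none, in accordance with \<open>a div 0 = 0\<close>.\<close>
  have "recf 2 (\<lambda>e. rec_nat 0 (\<lambda>m r. if Suc m mod e (Suc 0) = 0 then Suc r else r) (e 0))"
    by (intro recf_rec_nat recf_var recf_const recf_Suc recf_If recp_eq recf_mod) auto
  moreover have "rec_nat 0 (\<lambda>m r. if Suc m mod b = 0 then Suc r else r) a = a div b" for a b :: nat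
    by (induction a) (auto simp: div_Suc)
  ultimately have "recf 2 (\<lambda>e. e 0 div e (Suc 0))"
    by simp
  then show "recf n f \<Longrightarrow> recf n g \<Longrightarrow> recf n (\<lambda>e. f e div g e)"
    by (rule recf_subst2[where h = "(div)"])
qed

lemma recp_odd: "recf n f \<Longrightarrow> recp n (\<lambda>e. odd (f e))"
  unfolding odd_iff_mod_2_eq_one by (intro recp_eq recf_mod recf_const)

text \<open>\<open>Mu\<close> looks for a zero, so it is applied to the indicator of the negation.
  This indicator is total, so the search cannot get stuck before the witness, and the second
  assumption guarantees that it ends.\<close>

lemma recf_Least:
  assumes "recp (Suc n) (\<lambda>e. P (e 0) (\<lambda>i. e (Suc i)))" "\<And>e. \<exists>m. P m e"
  shows "recf n (\<lambda>e. LEAST m. P m e)"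
proof -
  have "recf (Suc n) (\<lambda>e. of_bool (\<not> P (e 0) (\<lambda>i. e (Suc i))))"
    by (intro recf_of_bool recp_not assms(1))
  then obtain q where q: "\<And>e. run q {} (map e [0..<Suc n])
      = Some (of_bool (\<not> P (e 0) (\<lambda>i. e (Suc i))))"
    unfolding recf_def by blast
  have q': "run q {} (m # map e [0..<n]) = Some (of_bool (\<not> P m e))" for m e
    using q[of "\<lambda>i. case i of 0 \<Rightarrow> m | Suc i \<Rightarrow> e i"]
    by (simp add: map_upt_Suc del: upt_Suc)
  have "run (Mu q) {} (map e [0..<n]) = Some (LEAST m. P m e)" for e
  proof -
    define R where "R m \<longleftrightarrow> run q {} (m # map e [0..<n]) = Some 0 \<and>
       (\<forall>i<m. \<exists>y. run q {} (i # map e [0..<n]) = Some (Suc y))" for m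
    have *: "R m \<longleftrightarrow> P m e \<and> (\<forall>i<m. \<not> P i e)" for m
      by (auto simp: R_def q')
    have "R (LEAST m. P m e)"
      unfolding * using assms(2)[of e] by (auto intro: LeastI_ex dest: not_less_Least)
    moreover have "m = (LEAST m. P m e)" if "R m" for m
      using that unfolding * by (metis LeastI nat_neq_iff not_less_Least)
    ultimately have "(THE m. R m) = (LEAST m. P m e)" and "\<exists>m. R m"
      by (blast intro: the_equality)+
    then show ?thesis
      unfolding run.simps R_def by (simp only: if_True)
  qed
  then show ?thesis
    unfolding recf_def by blast
qed

lemmas rec_intros = recf_var recf_const recf_Suc recf_add recf_mult recf_power recf_diff recf_mod
  recf_div recf_If recf_of_bool recp_not recp_conj recp_disj recp_imp recp_iff recp_le recp_less
  recp_eq recp_odd recp_ex recp_all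

section \<open>Pairing and its inverses\<close>

lemma recf_prod_encode: "recf n f \<Longrightarrow> recf n g \<Longrightarrow> recf n (\<lambda>e. prod_encode (f e, g e))"
  unfolding prod_encode_def triangle_def prod.case by (intro rec_intros)

text \<open>A component of a pair never exceeds the code of the pair, so it can be found by bounded
  search; the search is written as a sum with at most one nonzero term.\<close>

lemma recf_fst_prod_decode: "recf n f \<Longrightarrow> recf n (\<lambda>e. fst (prod_decode (f e)))"
proof -
  have "recf 1 (\<lambda>e. \<Sum>i<Suc (e 0). i * of_bool (\<exists>j<Suc (e 0). prod_encode (i, j) = e 0))"
    by (intro recf_sum rec_intros recf_prod_encode) auto
  moreover have "(\<Sum>i<Suc z. i * of_bool (\<exists>j<Suc z. prod_encode (i, j) = z)) = fst (prod_decode z)" for z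
  proof -
    obtain a b where z: "z = prod_encode (a, b)"
      by (metis prod_decode_inverse surj_pair)
    have "a < Suc z" "b < Suc z"
      using le_prod_encode_1[of a b] le_prod_encode_2[of b a] z by auto
    then have "(\<exists>j<Suc z. prod_encode (i, j) = z) \<longleftrightarrow> i = a" for i
      using z by (auto simp: prod_encode_eq)
    then have "(\<Sum>i<Suc z. i * of_bool (\<exists>j<Suc z. prod_encode (i, j) = z))
        = (\<Sum>i<Suc z. if i = a then a else 0)"
      by (intro sum.cong) auto
    then show ?thesis
      using \<open>a < Suc z\<close> z by simp
  qed
  ultimately have "recf 1 (\<lambda>e. fst (prod_decode (e 0)))"
    by simp
  then show "recf n f \<Longrightarrow> recf n (\<lambda>e. fst (prod_decode (f e)))"
    by (rule recf_subst1[where h = "\<lambda>x. fst (prod_decode x)"])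
qed

lemma recf_snd_prod_decode: "recf n f \<Longrightarrow> recf n (\<lambda>e. snd (prod_decode (f e)))"
proof -
  have "recf 1 (\<lambda>e. \<Sum>i<Suc (e 0). i * of_bool (prod_encode (fst (prod_decode (e 0)), i) = e 0))"
    by (intro recf_sum rec_intros recf_prod_encode recf_fst_prod_decode) auto
  moreover have "(\<Sum>i<Suc z. i * of_bool (prod_encode (fst (prod_decode z), i) = z)) = snd (prod_decode z)" for z
  proof -
    obtain a b where z: "z = prod_encode (a, b)"
      by (metis prod_decode_inverse surj_pair)
    have b: "b < Suc z"
      using le_prod_encode_2[of b a] z by auto
    have "(\<Sum>i<Suc z. i * of_bool (prod_encode (fst (prod_decode z), i) = z))
        = (\<Sum>i<Suc z. if i = b then b else 0)"
      using z by (intro sum.cong) (auto simp: prod_encode_eq)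
    then show ?thesis
      using b z by simp
  qed
  ultimately have "recf 1 (\<lambda>e. snd (prod_decode (e 0)))"
    by simp
  then show "recf n f \<Longrightarrow> recf n (\<lambda>e. snd (prod_decode (f e)))"
    by (rule recf_subst1[where h = "\<lambda>x. snd (prod_decode x)"])
qed

section \<open>Finite approximations of oracle computations\<close>

text \<open>
  \<open>g t e xs\<close> is \<open>0\<close> if the computation is not seen to converge at stage \<open>t\<close>, and \<open>Suc y\<close> if it is seen
  to converge to \<open>y\<close>.  The oracle is only known below \<open>t\<close>, where it agrees with the set coded by \<open>e\<close>.
\<close>

definition approximates :: "prog \<Rightarrow> nat \<Rightarrow> (nat \<Rightarrow> nat \<Rightarrow> nat list \<Rightarrow> nat) \<Rightarrow> bool" where
  "approximates p n g \<longleftrightarrow>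
     recf (Suc (Suc n)) (\<lambda>v. g (v 0) (v (Suc 0)) (map (\<lambda>i. v (Suc (Suc i))) [0..<n])) \<and>
     (\<forall>t e xs y X. length xs = n \<longrightarrow> g t e xs = Suc y \<longrightarrow> X \<inter> {..<t} = set_decode e \<inter> {..<t}
        \<longrightarrow> run p X xs = Some y) \<and>
     (\<forall>X xs y. length xs = n \<longrightarrow> run p X xs = Some y \<longrightarrow>
        (\<forall>\<^sub>F t in sequentially. \<forall>e. X \<inter> {..<t} = set_decode e \<inter> {..<t} \<longrightarrow> g t e xs = Suc y))"

lemma approximatesI:
  assumes "recf (Suc (Suc n)) (\<lambda>v. g (v 0) (v (Suc 0)) (map (\<lambda>i. v (Suc (Suc i))) [0..<n]))"
    and "\<And>t e xs y X. length xs = n \<Longrightarrow> g t e xs = Suc y \<Longrightarrow> X \<inter> {..<t} = set_decode e \<inter> {..<t}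
        \<Longrightarrow> run p X xs = Some y"
    and "\<And>X xs y. length xs = n \<Longrightarrow> run p X xs = Some y \<Longrightarrow>
        \<forall>\<^sub>F t in sequentially. \<forall>e. X \<inter> {..<t} = set_decode e \<inter> {..<t} \<longrightarrow> g t e xs = Suc y"
  shows "approximates p n g"
  using assms unfolding approximates_def by blast

lemma approximatesD:
  assumes "approximates p n g" "length xs = n"
  shows "g t e xs = Suc y \<Longrightarrow> X \<inter> {..<t} = set_decode e \<inter> {..<t} \<Longrightarrow> run p X xs = Some y"
    and "run p X xs = Some y \<Longrightarrow>
        \<forall>\<^sub>F t in sequentially. \<forall>e. X \<inter> {..<t} = set_decode e \<inter> {..<t} \<longrightarrow> g t e xs = Suc y"
  using assms unfolding approximates_def by blast+

lemma approximates_recf: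
  assumes g: "approximates p m g" and f: "recf n a" "recf n b" "\<And>i. i < m \<Longrightarrow> recf n (f i)"
  shows "recf n (\<lambda>v. g (a v) (b v) (map (\<lambda>i. f i v) [0..<m]))"
proof -
  have g': "recf (Suc (Suc m)) (\<lambda>v. g (v 0) (v (Suc 0)) (map (\<lambda>i. v (Suc (Suc i))) [0..<m]))"
    using g by (simp add: approximates_def)
  define h where "h i = (case i of 0 \<Rightarrow> a | Suc j \<Rightarrow> (case j of 0 \<Rightarrow> b | Suc l \<Rightarrow> f l))" for i
  have "recf n (h i)" if "i < Suc (Suc m)" for i
    using that f by (auto simp: h_def split: nat.split)
  from recf_subst[OF g', where f = h, OF this] show ?thesis
    by (simp add: h_def)
qed

text \<open>Here \<open>m\<close> is a fixed number and the predicates \<open>P i\<close> come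
  without any uniformity in \<open>i\<close>, in contrast to \<open>recp_all\<close>. Such a
  conjunction arises from the list of programs in \<open>Comp\<close>.\<close>

lemma recp_all_list:
  fixes m :: nat
  assumes "\<And>i. i < m \<Longrightarrow> recp n (P i)"
  shows "recp n (\<lambda>v. \<forall>i<m. P i v)"
  using assms
proof (induction m)
  case 0
  then show ?case
    using recf_const[of n 1] by (simp add: recp_def)
next
  case (Suc m)
  then have "recp n (\<lambda>v. P m v \<and> (\<forall>i<m. P i v))"
    by (intro recp_conj) auto
  then show ?case
    by (simp add: All_less_Suc)
qed

section \<open>Approximations for the basic functions and the closure operations\<close>

lemma approximates_Zero: "approximates Zero n (\<lambda>t e xs. 1)"
  by (rule approximatesI) (auto intro: recf_const)

lemma approximates_None: "(\<And>X xs. length xs = n \<Longrightarrow> run p X xs = None) \<Longrightarrow> approximates p n (\<lambda>t e xs. 0)"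
  by (rule approximatesI) (auto intro: recf_const)

lemma approximates_Succ: "\<exists>g. approximates Succ n g"
proof (cases "n = 1")
  case True
  have "approximates Succ n (\<lambda>t e xs. Suc (Suc (xs ! 0)))"
  proof (rule approximatesI)
    have "recf (Suc (Suc n)) (\<lambda>v. Suc (Suc (v (Suc (Suc 0)))))"
      using True by (intro recf_Suc recf_var) simp
    then show "recf (Suc (Suc n)) (\<lambda>v. Suc (Suc (map (\<lambda>i. v (Suc (Suc i))) [0..<n] ! 0)))"
      using True by simp
  next
    fix t e xs y and X :: "nat set"
    assume "length xs = n" "Suc (Suc (xs ! 0)) = Suc y"
    then show "run Succ X xs = Some y"
      using True by (cases xs rule: remdups_adj.cases) auto
  next
    fix X xs y
    assume "length xs = n" "run Succ X xs = Some y"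
    then have "Suc (xs ! 0) = y"
      using True by (cases xs rule: remdups_adj.cases) auto
    then show "\<forall>\<^sub>F t in sequentially. \<forall>e. X \<inter> {..<t} = set_decode e \<inter> {..<t} \<longrightarrow>
        Suc (Suc (xs ! 0)) = Suc y"
      by simp
  qed
  then show ?thesis
    by blast
next
  case False
  have "run Succ X xs = None" if "length xs = n" for X xs
    using that False by (cases xs rule: remdups_adj.cases) auto
  then have "approximates Succ n (\<lambda>t e xs. 0)"
    by (rule approximates_None)
  then show ?thesis
    by blast
qed

lemma approximates_Proj: "\<exists>g. approximates (Proj i) n g"
proof (cases "i < n")
  case True
  then have "approximates (Proj i) n (\<lambda>t e xs. Suc (xs ! i))"
    by (intro approximatesI) (auto intro: recf_Suc recf_var)
  then show ?thesis
    by blast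
next
  case False
  then have "approximates (Proj i) n (\<lambda>t e xs. 0)"
    by (intro approximates_None) auto
  then show ?thesis
    by blast
qed

lemma approximates_Oracle: "\<exists>g. approximates Oracle n g"
proof (cases "n = 1")
  case True
  \<comment> \<open>A query is answered from the bits of \<open>e\<close>, and only below
    \<open>t\<close>, since the oracle is unknown from \<open>t\<close> on.\<close>
  let ?g = "\<lambda>t e xs. if xs ! 0 < t then Suc (of_bool (odd (e div 2 ^ (xs ! 0)))) else 0 :: nat"
  have "approximates Oracle n ?g"
  proof (rule approximatesI)
    have "recf (Suc (Suc (Suc 0))) (\<lambda>v. if v (Suc (Suc 0)) < v 0
        then Suc (of_bool (odd (v (Suc 0) div 2 ^ v (Suc (Suc 0))))) else 0)"
      by (intro rec_intros) auto
    then show "recf (Suc (Suc n)) (\<lambda>v. ?g (v 0) (v (Suc 0)) (map (\<lambda>i. v (Suc (Suc i))) [0..<n]))"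
      using True by (simp cong: if_cong)
  next
    fix t e xs y X
    assume a: "length xs = n" "?g t e xs = Suc y" "X \<inter> {..<t} = set_decode e \<inter> {..<t}"
    obtain x where x: "xs = [x]"
      using a(1) True by (auto simp: length_Suc_conv)
    then have "x \<in> X \<longleftrightarrow> x \<in> set_decode e"
      using a(2,3) by (auto split: if_splits)
    then show "run Oracle X xs = Some y"
      using a(2) x by (auto simp: char_fun_def set_decode_def split: if_splits)
  next
    fix X :: "nat set" and xs y
    assume a: "length xs = n" "run Oracle X xs = Some y"
    obtain x where x: "xs = [x]"
      using a(1) True by (auto simp: length_Suc_conv)
    show "\<forall>\<^sub>F t in sequentially. \<forall>e. X \<inter> {..<t} = set_decode e \<inter> {..<t} \<longrightarrow> ?g t e xs = Suc y"
      using eventually_gt_at_top[of x]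
    proof eventually_elim
      case (elim t)
      have "x \<in> X \<longleftrightarrow> x \<in> set_decode e" if "X \<inter> {..<t} = set_decode e \<inter> {..<t}" for e
        using that elim by auto
      moreover have "y = of_bool (x \<in> X)"
        using x a(2) by (auto simp: char_fun_def)
      ultimately show ?case
        using x elim by (simp add: set_decode_def)
    qed
  qed
  then show ?thesis
    by blast
next
  case False
  have "run Oracle X xs = None" if "length xs = n" for X xs
    using that False by (cases xs rule: remdups_adj.cases) auto
  then have "approximates Oracle n (\<lambda>t e xs. 0)"
    by (rule approximates_None)
  then show ?thesis
    by blast
qed

lemma those_eq_Some_iff: "those xs = Some ys \<longleftrightarrow> xs = map Some ys"
  by (induction xs arbitrary: ys) (auto split: option.split)

lemma approximates_Comp:
  assumes f: "approximates f (length gs) gf" and gs: "\<And>h. h \<in> set gs \<Longrightarrow> approximates h n (G h)"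
  shows "\<exists>g. approximates (Comp f gs) n g"
proof -
  let ?y = "\<lambda>i t e xs. G (gs ! i) t e xs"
  let ?m = "length gs"
  \<comment> \<open>Values are offset by one: a zero component leaves the whole computation
    undefined at this stage, and otherwise the components are decremented before \<open>gf\<close>
    is applied.\<close>
  define g where "g t e xs = (if \<forall>i<?m. 0 < ?y i t e xs
      then gf t e (map (\<lambda>i. ?y i t e xs - 1) [0..<?m]) else 0)" for t e xs
  have G: "approximates (gs ! i) n (G (gs ! i))" if "i < ?m" for i
    using gs that by simp
  have "approximates (Comp f gs) n g"
  proof (rule approximatesI)
    have "recf (Suc (Suc n)) (\<lambda>v. ?y i (v 0) (v (Suc 0)) (map (\<lambda>i. v (Suc (Suc i))) [0..<n]))"
      if "i < ?m" for i
      using G[OF that] by (simp add: approximates_def)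
    then show "recf (Suc (Suc n)) (\<lambda>v. g (v 0) (v (Suc 0)) (map (\<lambda>i. v (Suc (Suc i))) [0..<n]))"
      unfolding g_def
      by (intro recf_If recp_all_list recp_less recf_const approximates_recf[OF f] recf_diff recf_var)
        simp_all
  next
    fix t e xs y X
    assume a: "length xs = n" "g t e xs = Suc y" "X \<inter> {..<t} = set_decode e \<inter> {..<t}"
    let ?ys = "map (\<lambda>i. ?y i t e xs - 1) [0..<?m]"
    from a(2) have b: "\<forall>i<?m. 0 < ?y i t e xs" and c: "gf t e ?ys = Suc y"
      by (auto simp: g_def split: if_splits)
    have "run (gs ! i) X xs = Some (?ys ! i)" if "i < ?m" for i
      using approximatesD(1)[OF G[OF that] a(1) _ a(3)] b that by simp
    then have "map (\<lambda>h. run h X xs) gs = map Some ?ys"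
      by (intro nth_equalityI) auto
    moreover have "run f X ?ys = Some y"
      using approximatesD(1)[OF f _ c a(3)] by simp
    ultimately show "run (Comp f gs) X xs = Some y"
      by (simp only: run.simps those_eq_Some_iff[THEN iffD2] bind.bind_lunit)
  next
    fix X :: "nat set" and xs y
    assume a: "length xs = n" "run (Comp f gs) X xs = Some y"
    then obtain ys where ys: "those (map (\<lambda>h. run h X xs) gs) = Some ys" and y: "run f X ys = Some y"
      by (auto simp: bind_eq_Some_conv)
    then have ys': "map (\<lambda>h. run h X xs) gs = map Some ys"
      by (simp add: those_eq_Some_iff)
    then have len: "length ys = ?m"
      by (metis length_map)
    have r: "run (gs ! i) X xs = Some (ys ! i)" if "i < ?m" for i
      using arg_cong[OF ys', of "\<lambda>l. l ! i"] that len by simp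
    have "\<forall>\<^sub>F t in sequentially. \<forall>i\<in>{..<?m}. \<forall>e. X \<inter> {..<t} = set_decode e \<inter> {..<t} \<longrightarrow>
        ?y i t e xs = Suc (ys ! i)"
      using approximatesD(2)[OF G a(1) r] by (intro eventually_ball_finite) auto
    moreover note approximatesD(2)[OF f len y]
    ultimately show "\<forall>\<^sub>F t in sequentially. \<forall>e. X \<inter> {..<t} = set_decode e \<inter> {..<t} \<longrightarrow> g t e xs = Suc y"
    proof eventually_elim
      case (elim t)
      show ?case
      proof (intro allI impI)
        fix e
        assume e: "X \<inter> {..<t} = set_decode e \<inter> {..<t}"
        then have b: "?y i t e xs = Suc (ys ! i)" if "i < ?m" for i
          using elim(1) that by auto
        then have "map (\<lambda>i. ?y i t e xs - 1) [0..<?m] = ys"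
          by (intro nth_equalityI) (auto simp: len)
        then show "g t e xs = Suc y"
          using b elim(2) e by (simp add: g_def)
      qed
    qed
  qed
  then show ?thesis
    by blast
qed

lemma approximates_PrimRec:
  assumes f: "approximates f n gf" and h: "approximates h (Suc (Suc n)) gh"
  shows "\<exists>g. approximates (PrimRec f h) (Suc n) g"
proof -
  \<comment> \<open>A value 0, meaning that convergence is not yet seen, propagates through all
    later recursion steps.\<close>
  define r where "r t e ys = rec_nat (gf t e ys) (\<lambda>m r. if r = 0 then 0 else gh t e (m # (r - 1) # ys))"
    for t e ys
  have r_simps: "r t e ys 0 = gf t e ys"
      "r t e ys (Suc m) = (if r t e ys m = 0 then 0 else gh t e (m # (r t e ys m - 1) # ys))" for t e ys m
    by (simp_all add: r_def)
  define R where "R X ys = rec_nat (run f X ys) (\<lambda>m r. Option.bind r (\<lambda>y. run h X (m # y # ys)))" for X ys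
  have R_simps: "R X ys 0 = run f X ys"
      "R X ys (Suc m) = Option.bind (R X ys m) (\<lambda>y. run h X (m # y # ys))" for X ys m
    by (simp_all add: R_def)
  have run: "run (PrimRec f h) X (x # ys) = R X ys x" for X x ys
    by (simp add: R_def)
  have "approximates (PrimRec f h) (Suc n) (\<lambda>t e xs. r t e (tl xs) (hd xs))"
  proof (rule approximatesI)
    have "recf (Suc (Suc (Suc n))) (\<lambda>v. rec_nat (gf (v 0) (v (Suc 0)) (map (\<lambda>i. v (Suc (Suc (Suc i)))) [0..<n]))
       (\<lambda>m r. if r = 0 then 0 else
          gh (v 0) (v (Suc 0)) (m # (r - 1) # map (\<lambda>i. v (Suc (Suc (Suc i)))) [0..<n])) (v 2))"
    proof (intro recf_rec_nat approximates_recf[OF f] recf_If recp_eq recf_var recf_const)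
      let ?f = "\<lambda>i. case i of 0 \<Rightarrow> \<lambda>v. v 0
        | Suc j \<Rightarrow> (case j of 0 \<Rightarrow> \<lambda>v. v (Suc 0) - 1 | Suc l \<Rightarrow> \<lambda>v. v (Suc (Suc (Suc (Suc (Suc l))))))"
      have "recf (Suc (Suc (Suc (Suc (Suc n))))) (\<lambda>v. gh (v (Suc (Suc 0))) (v (Suc (Suc (Suc 0))))
          (map (\<lambda>i. ?f i v) [0..<Suc (Suc n)]))"
        by (intro approximates_recf[OF h])
          (auto split: nat.split intro!: recf_var recf_diff recf_const)
      then show "recf (Suc (Suc (Suc (Suc (Suc n))))) (\<lambda>v. gh (v (Suc (Suc 0))) (v (Suc (Suc (Suc 0))))
          (v 0 # (v (Suc 0) - 1) # map (\<lambda>i. v (Suc (Suc (Suc (Suc (Suc i)))))) [0..<n]))"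
        by (simp add: map_upt_Suc del: upt_Suc)
    qed auto
    then show "recf (Suc (Suc (Suc n))) (\<lambda>v. r (v 0) (v (Suc 0)) (tl (map (\<lambda>i. v (Suc (Suc i))) [0..<Suc n]))
         (hd (map (\<lambda>i. v (Suc (Suc i))) [0..<Suc n])))"
      by (simp add: r_def map_upt_Suc numeral_2_eq_2 del: upt_Suc)
  next
    fix t e xs y X
    assume a: "length xs = Suc n" "r t e (tl xs) (hd xs) = Suc y" "X \<inter> {..<t} = set_decode e \<inter> {..<t}"
    obtain x ys where xs: "xs = x # ys" "length ys = n"
      using a(1) by (auto simp: length_Suc_conv)
    have "r t e ys x = Suc y \<Longrightarrow> R X ys x = Some y" for x y
    proof (induction x arbitrary: y)
      case 0
      then show ?case
        using approximatesD(1)[OF f xs(2) _ a(3)] by (simp add: r_simps R_simps)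
    next
      case (Suc x)
      then obtain z where z: "r t e ys x = Suc z" "gh t e (x # z # ys) = Suc y"
        by (cases "r t e ys x") (auto simp: r_simps)
      then show ?case
        using approximatesD(1)[OF h _ z(2) a(3)] Suc.IH[OF z(1)] xs(2) by (simp add: R_simps)
    qed
    then show "run (PrimRec f h) X xs = Some y"
      using a(2) xs(1) by (simp add: run del: run.simps)
  next
    fix X :: "nat set" and xs y
    assume a: "length xs = Suc n" "run (PrimRec f h) X xs = Some y"
    obtain x ys where xs: "xs = x # ys" "length ys = n"
      using a(1) by (auto simp: length_Suc_conv)
    have "R X ys x = Some y \<Longrightarrow> \<forall>\<^sub>F t in sequentially. \<forall>e.
        X \<inter> {..<t} = set_decode e \<inter> {..<t} \<longrightarrow> r t e ys x = Suc y" for x y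
    proof (induction x arbitrary: y)
      case 0
      then show ?case
        using approximatesD(2)[OF f xs(2)] by (simp add: r_simps R_simps)
    next
      case (Suc x)
      then obtain z where z: "R X ys x = Some z" "run h X (x # z # ys) = Some y"
        by (auto simp: R_simps bind_eq_Some_conv)
      have "length (x # z # ys) = Suc (Suc n)"
        using xs(2) by simp
      from approximatesD(2)[OF h this z(2)] Suc.IH[OF z(1)] show ?case
        by eventually_elim (auto simp: r_simps)
    qed
    then show "\<forall>\<^sub>F t in sequentially. \<forall>e. X \<inter> {..<t} = set_decode e \<inter> {..<t} \<longrightarrow> r t e (tl xs) (hd xs) = Suc y"
      using a(2) xs(1) by (simp add: run del: run.simps)
  qed
  then show ?thesis
    by blast
qed

lemma approximates_Mu:
  assumes f: "approximates f (Suc n) gf"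
  shows "\<exists>g. approximates (Mu f) n g"
proof -
  \<comment> \<open>With the offset by one, the value 1 encodes the output 0, and values from 2 on
    encode positive outputs.\<close>
  define M where "M t e xs m \<longleftrightarrow> gf t e (m # xs) = 1 \<and> (\<forall>l<m. 2 \<le> gf t e (l # xs))" for t e xs m
  define R where "R X xs m \<longleftrightarrow> run f X (m # xs) = Some 0 \<and> (\<forall>l<m. \<exists>y. run f X (l # xs) = Some (Suc y))"
    for X xs m
  \<comment> \<open>At most one \<open>m\<close> satisfies \<open>M\<close>, so the sum extracts it;
    bounding the search by the stage \<open>t\<close> makes \<open>g\<close> total.\<close>
  define g where "g t e xs = (\<Sum>m<t. if M t e xs m then Suc m else 0)" for t e xs
  have run: "run (Mu f) X xs = (if \<exists>m. R X xs m then Some (THE m. R X xs m) else None)" for X xs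
    by (simp add: R_def)
  have R_unique: "R X xs m \<Longrightarrow> R X xs m' \<Longrightarrow> m = m'" for X xs m m'
    unfolding R_def by (metis linorder_neqE_nat nat.distinct(1) option.inject)
  have M_unique: "M t e xs m \<Longrightarrow> M t e xs m' \<Longrightarrow> m = m'" for t e xs m m'
    unfolding M_def by (cases m m' rule: linorder_cases) fastforce+
  have g_eq: "g t e xs = Suc m" if "m < t" "M t e xs m" for t e xs m
  proof -
    have "g t e xs = (\<Sum>i<t. if i = m then Suc m else 0)"
      unfolding g_def using M_unique that by (intro sum.cong) auto
    then show ?thesis
      using that by simp
  qed
  have run_eq: "run (Mu f) X xs = Some m \<longleftrightarrow> R X xs m" for X xs m
    unfolding run using R_unique by (auto intro: the_equality theI)
  have "approximates (Mu f) n g"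
  proof (rule approximatesI)
    have gf: "recf (Suc (Suc (Suc n))) (\<lambda>v. gf (v (Suc 0)) (v (Suc (Suc 0)))
        (v 0 # map (\<lambda>i. v (Suc (Suc (Suc i)))) [0..<n]))"
    proof -
      let ?f = "\<lambda>i. case i of 0 \<Rightarrow> \<lambda>v. v 0 | Suc j \<Rightarrow> \<lambda>v. v (Suc (Suc (Suc j)))"
      have "recf (Suc (Suc (Suc n))) (\<lambda>v. gf (v (Suc 0)) (v (Suc (Suc 0))) (map (\<lambda>i. ?f i v) [0..<Suc n]))"
        by (intro approximates_recf[OF f]) (auto split: nat.split intro!: recf_var)
      then show ?thesis
        by (simp add: map_upt_Suc del: upt_Suc)
    qed
    have gf': "recf (Suc (Suc (Suc (Suc n)))) (\<lambda>v. gf (v (Suc (Suc 0))) (v (Suc (Suc (Suc 0))))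
        (v 0 # map (\<lambda>i. v (Suc (Suc (Suc (Suc i))))) [0..<n]))"
    proof -
      let ?f = "\<lambda>i. case i of 0 \<Rightarrow> \<lambda>v. v 0 | Suc j \<Rightarrow> \<lambda>v. v (Suc (Suc (Suc (Suc j))))"
      have "recf (Suc (Suc (Suc (Suc n)))) (\<lambda>v. gf (v (Suc (Suc 0))) (v (Suc (Suc (Suc 0))))
          (map (\<lambda>i. ?f i v) [0..<Suc n]))"
        by (intro approximates_recf[OF f]) (auto split: nat.split intro!: recf_var)
      then show ?thesis
        by (simp add: map_upt_Suc del: upt_Suc)
    qed
    show "recf (Suc (Suc n)) (\<lambda>v. g (v 0) (v (Suc 0)) (map (\<lambda>i. v (Suc (Suc i))) [0..<n]))"
      unfolding g_def M_def
      by (intro recf_sum recf_If recp_conj recp_eq recp_all recp_le gf gf' recf_const recf_Suc recf_var)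
        auto
  next
    fix t e xs y X
    assume a: "length xs = n" "g t e xs = Suc y" "X \<inter> {..<t} = set_decode e \<inter> {..<t}"
    have "\<exists>m<t. M t e xs m"
    proof (rule ccontr)
      assume "\<not> (\<exists>m<t. M t e xs m)"
      then have "g t e xs = 0"
        by (simp add: g_def)
      then show False
        using a(2) by simp
    qed
    then obtain m where m: "m < t" "M t e xs m"
      by blast
    then have "m = y"
      using g_eq a(2) by simp
    have s: "run f X (l # xs) = Some y" if "gf t e (l # xs) = Suc y" for l y
      using approximatesD(1)[OF f _ that a(3)] a(1) by simp
    have "\<exists>y. run f X (l # xs) = Some (Suc y)" if "l < m" for l
    proof -
      have "2 \<le> gf t e (l # xs)"
        using m(2) that by (auto simp: M_def)
      then obtain z where "gf t e (l # xs) = Suc (Suc z)"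
        by (metis add_2_eq_Suc le_Suc_ex)
      then show ?thesis
        using s by blast
    qed
    then have "R X xs m"
      using m(2) s by (auto simp: R_def M_def)
    then show "run (Mu f) X xs = Some y"
      using \<open>m = y\<close> run_eq by blast
  next
    fix X :: "nat set" and xs y
    assume a: "length xs = n" "run (Mu f) X xs = Some y"
    then have R: "R X xs y"
      using run_eq by blast
    \<comment> \<open>Convergence to \<open>y\<close> involves only the finitely many computations
      at \<open>l \<le> y\<close>, so eventually a single stage sees all of them.\<close>
    have "\<forall>l. \<exists>z. l \<le> y \<longrightarrow> run f X (l # xs) = Some z \<and> (z = 0 \<longleftrightarrow> l = y)"
      using R unfolding R_def by (metis Zero_not_Suc le_neq_implies_less)
    then obtain z where z: "\<And>l. l \<le> y \<Longrightarrow> run f X (l # xs) = Some (z l) \<and> (z l = 0 \<longleftrightarrow> l = y)"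
      by metis
    have "\<forall>\<^sub>F t in sequentially. \<forall>l\<in>{..y}. \<forall>e. X \<inter> {..<t} = set_decode e \<inter> {..<t} \<longrightarrow>
        gf t e (l # xs) = Suc (z l)"
      using approximatesD(2)[OF f] z a(1) by (intro eventually_ball_finite) auto
    then show "\<forall>\<^sub>F t in sequentially. \<forall>e. X \<inter> {..<t} = set_decode e \<inter> {..<t} \<longrightarrow> g t e xs = Suc y"
      using eventually_gt_at_top[of y]
    proof eventually_elim
      case (elim t)
      show ?case
      proof (intro allI impI)
        fix e
        assume "X \<inter> {..<t} = set_decode e \<inter> {..<t}"
        then have l: "gf t e (l # xs) = Suc (z l)" if "l \<le> y" for l
          using elim(1) that by auto
        have "2 \<le> gf t e (l # xs)" if "l < y" for l
          using l[of l] z[of l] that by auto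
        then have "M t e xs y"
          using l[of y] z[of y] by (auto simp: M_def)
        then show "g t e xs = Suc y"
          using g_eq elim(2) by blast
      qed
    qed
  qed
  then show ?thesis
    by blast
qed

text \<open>The arity is generalised in the induction, since composition, recursion and minimisation
  all change it.\<close>

lemma ex_approximates: "\<exists>g. approximates p n g"
proof (induction p arbitrary: n)
  case Zero
  then show ?case
    using approximates_Zero by blast
next
  case (Comp f gs)
  obtain gf where "approximates f (length gs) gf"
    using Comp.IH(1) by blast
  moreover have "\<forall>h. \<exists>g. h \<in> set gs \<longrightarrow> approximates h n g"
    using Comp.IH(2) by blast
  then obtain G where "\<And>h. h \<in> set gs \<Longrightarrow> approximates h n (G h)"
    by metis
  ultimately show ?case
    by (rule approximates_Comp)
next
  case (PrimRec f h)
  show ?case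
  proof (cases n)
    case 0
    then have "approximates (PrimRec f h) n (\<lambda>t e xs. 0)"
      by (intro approximates_None) auto
    then show ?thesis
      by blast
  next
    case (Suc n)
    then show ?thesis
      using PrimRec.IH approximates_PrimRec by metis
  qed
next
  case (Mu f)
  then show ?case
    using approximates_Mu by blast
qed (rule approximates_Succ approximates_Proj approximates_Oracle)+

section \<open>Diagonalizing against all partitions\<close>

text \<open>This is Koenig's lemma for the tree of sequences with values below \<open>k\<close>. If
  no bound is uniform, the empty sequence is bad: its extensions admit no uniform bound. As there
  are only finitely many next values, a bad sequence has a bad one-step extension, since otherwise
  the maximum of the individual bounds would do. The limit \<open>A\<close> of a path of bad
  sequences satisfies some \<open>P n\<close>, and by \<open>loc\<close> so does every extension of
  its first \<open>n\<close> values, contradicting badness at length \<open>n\<close>.\<close>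

lemma konig_compactness:
  fixes P :: "nat \<Rightarrow> (nat \<Rightarrow> nat) \<Rightarrow> bool"
  assumes mono: "\<And>n n' A. P n A \<Longrightarrow> n \<le> n' \<Longrightarrow> P n' A"
    and loc: "\<And>n A B. P n A \<Longrightarrow> \<forall>i<n. A i = B i \<Longrightarrow> P n B"
    and ex: "\<And>A. \<forall>i. A i < k \<Longrightarrow> \<exists>n. P n A"
  shows "\<exists>n. \<forall>A. (\<forall>i. A i < k) \<longrightarrow> P n A"
proof (rule ccontr)
  assume contra: "\<not> ?thesis"
  define bad where "bad m B \<longleftrightarrow> (\<forall>n. \<exists>A. (\<forall>i. A i < k) \<and> (\<forall>i<m. A i = B i) \<and> \<not> P n A)" for m B
  have "\<exists>B'. bad (Suc m) B' \<and> (\<forall>i<m. B' i = B i)" if B: "bad m B" for m B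
  proof (rule ccontr)
    assume neg: "\<not> ?thesis"
    have "\<forall>x. \<exists>n. \<forall>A. (\<forall>i. A i < k) \<longrightarrow> (\<forall>i<Suc m. A i = (B(m := x)) i) \<longrightarrow> P n A"
    proof
      fix x
      have "\<forall>i<m. (B(m := x)) i = B i"
        by simp
      then have "\<not> bad (Suc m) (B(m := x))"
        using neg by blast
      then show "\<exists>n. \<forall>A. (\<forall>i. A i < k) \<longrightarrow> (\<forall>i<Suc m. A i = (B(m := x)) i) \<longrightarrow> P n A"
        unfolding bad_def by blast
    qed
    then obtain N where N: "\<And>x A. \<forall>i. A i < k \<Longrightarrow> \<forall>i<Suc m. A i = (B(m := x)) i \<Longrightarrow> P (N x) A"
      by metis
    obtain A where A: "\<forall>i. A i < k" "\<forall>i<m. A i = B i" "\<not> P (Max (N ` {..<k})) A"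
      using B unfolding bad_def by blast
    have "P (N (A m)) A"
      using A by (intro N) (auto simp: less_Suc_eq)
    moreover have "N (A m) \<le> Max (N ` {..<k})"
      using A(1) by simp
    ultimately show False
      using mono A(3) by blast
  qed
  moreover have "bad 0 (\<lambda>_. 0)"
    using contra unfolding bad_def by auto
  ultimately obtain f where f: "\<And>n. bad n (f n)" "\<And>n. \<forall>i<n. f (Suc n) i = f n i"
    using dependent_nat_choice[of bad "\<lambda>n B B'. \<forall>i<n. B' i = B i"] by blast
  define A where "A i = f (Suc i) i" for i
  have f_A: "f (Suc (i + d)) i = A i" for i d
    by (induction d) (use f(2) in \<open>auto simp: A_def\<close>)
  have eq: "f n i = A i" if "i < n" for n i
    using f_A[of i "n - Suc i"] that by simp
  have "A i < k" for i
  proof -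
    obtain B where "\<forall>i. B i < k" "\<forall>j<Suc i. B j = f (Suc i) j"
      using f(1)[of "Suc i"] unfolding bad_def by blast
    then show ?thesis
      unfolding A_def by (metis lessI)
  qed
  then obtain n where n: "P n A"
    using ex by blast
  obtain B where "\<forall>i<n. B i = f n i" "\<not> P n B"
    using f(1)[of n] unfolding bad_def by blast
  then show False
    using loc[OF n, of B] eq by simp
qed

section \<open>Forcing with finite oracle conditions\<close>

definition forces :: "(nat set \<Rightarrow> nat \<Rightarrow> nat option) \<Rightarrow> nat \<Rightarrow> nat set \<Rightarrow> nat \<Rightarrow> bool" where
  "forces \<Psi> t E x \<longleftrightarrow> (\<forall>X. X \<inter> {..<t} = E \<longrightarrow> \<Psi> X x = Some 1)"

text \<open>A condition is strengthened by deciding more of the oracle: as \<open>F\<close> avoids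
  the numbers below \<open>t\<close>, every oracle that meets the new condition meets the old
  one.\<close>

lemma forces_extend:
  assumes "forces \<Psi> t E x" "E \<subseteq> {..<t}" "t \<le> n" "F \<subseteq> {t..<n}"
  shows "forces \<Psi> n (E \<union> F) x"
  unfolding forces_def
proof (intro allI impI)
  fix X
  assume "X \<inter> {..<n} = E \<union> F"
  moreover have "X \<inter> {..<t} = (X \<inter> {..<n}) \<inter> {..<t}"
    using assms(3) by auto
  ultimately have "X \<inter> {..<t} = E"
    using assms(2,4) by auto
  then show "\<Psi> X x = Some 1"
    using assms(1) by (auto simp: forces_def)
qed

text \<open>For the witness \<open>E\<close>, no oracle whose part below \<open>n\<close> is
  \<open>E\<close> can output a set homogeneous for \<open>c\<close>. Since all data lie below
  \<open>n\<close>, only finitely many values of \<open>c\<close> matter. For empty \<open>E\<close>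
  the class \<open>j\<close> is arbitrary.\<close>

definition killed ::
    "(nat set \<Rightarrow> nat \<Rightarrow> nat option) \<Rightarrow> nat \<Rightarrow> (nat \<Rightarrow> nat \<Rightarrow> bool) \<Rightarrow> (nat \<Rightarrow> nat) \<Rightarrow> nat \<Rightarrow> bool"
where
  "killed \<Psi> m c A n \<longleftrightarrow> (\<exists>E j u v x y. E \<subseteq> {a. m \<le> a \<and> a < n \<and> A a = j} \<and> u < v \<and> v < n \<and> x < y \<and> y < n
     \<and> (\<forall>z\<in>{u, v, x, y}. forces \<Psi> n E z) \<and> c u v \<noteq> c x y)"

lemma killedI:
  "E \<subseteq> {a. m \<le> a \<and> a < n \<and> A a = j} \<Longrightarrow> u < v \<Longrightarrow> v < n \<Longrightarrow> x < y \<Longrightarrow> y < n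
    \<Longrightarrow> (\<And>z. z \<in> {u, v, x, y} \<Longrightarrow> forces \<Psi> n E z) \<Longrightarrow> c u v \<noteq> c x y \<Longrightarrow> killed \<Psi> m c A n"
  unfolding killed_def by blast

lemma killed_mono:
  assumes "killed \<Psi> m c A n" "n \<le> n'"
  shows "killed \<Psi> m c A n'"
proof -
  obtain E j u v x y where *: "E \<subseteq> {a. m \<le> a \<and> a < n \<and> A a = j}" "u < v" "v < n" "x < y" "y < n"
      "\<forall>z\<in>{u, v, x, y}. forces \<Psi> n E z" "c u v \<noteq> c x y"
    using assms(1) unfolding killed_def by blast
  have "\<forall>z\<in>{u, v, x, y}. forces \<Psi> n' E z"
    using *(1,6) forces_extend[of \<Psi> n E _ n' "{}"] assms(2) by auto
  moreover have "E \<subseteq> {a. m \<le> a \<and> a < n' \<and> A a = j}"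
    using *(1) assms(2) by auto
  ultimately show ?thesis
    using *(2-5,7) assms(2) by (intro killedI[of E m n' A j u v x y]) auto
qed

definition agree :: "nat \<Rightarrow> (nat \<Rightarrow> nat \<Rightarrow> bool) \<Rightarrow> (nat \<Rightarrow> nat \<Rightarrow> bool) \<Rightarrow> bool" where
  "agree s c c' \<longleftrightarrow> (\<forall>v<s. \<forall>u<v. c u v = c' u v)"

lemma agree_trans: "agree s c c' \<Longrightarrow> agree s' c' c'' \<Longrightarrow> s \<le> s' \<Longrightarrow> agree s c c''"
  by (auto simp: agree_def)

text \<open>
  A set of partitions is good if densely many finite colorings kill all of its members; good sets form
  an ideal.
\<close>

definition good :: "(nat set \<Rightarrow> nat \<Rightarrow> nat option) \<Rightarrow> nat \<Rightarrow> (nat \<Rightarrow> nat) set \<Rightarrow> bool" where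
  "good \<Psi> m AA \<longleftrightarrow> (\<forall>c s. \<exists>c' s'. agree s c c' \<and> (\<forall>c''. agree s' c' c'' \<longrightarrow> (\<forall>A\<in>AA. killed \<Psi> m c'' A s')))"

text \<open>The sets are treated one after another: each extension preserves the finite part of the
  coloring on which the earlier kills depend, and kills persist to larger stages.\<close>

lemma good_UN: "finite I \<Longrightarrow> \<forall>i\<in>I. good \<Psi> m (AA i) \<Longrightarrow> good \<Psi> m (\<Union>i\<in>I. AA i)"
proof (induction rule: finite_induct)
  case empty
  then show ?case
    by (auto simp: good_def agree_def)
next
  case (insert i I)
  show ?case
    unfolding good_def
  proof (intro allI)
    fix c s
    obtain c1 s1 where 1: "agree s c c1" "\<And>c' A. agree s1 c1 c' \<Longrightarrow> A \<in> AA i \<Longrightarrow> killed \<Psi> m c' A s1"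
      using insert.prems unfolding good_def by (metis insertI1)
    have "good \<Psi> m (\<Union>i\<in>I. AA i)"
      using insert by simp
    then obtain c2 s2 where 2: "agree (max s s1) c1 c2"
        "\<And>c' A. agree s2 c2 c' \<Longrightarrow> A \<in> (\<Union>i\<in>I. AA i) \<Longrightarrow> killed \<Psi> m c' A s2"
      unfolding good_def by metis
    have "killed \<Psi> m c' A (max s1 s2)" if "agree (max s1 s2) c2 c'" "A \<in> (\<Union>i\<in>insert i I. AA i)" for c' A
    proof (cases "A \<in> AA i")
      case True
      have "agree s1 c1 c'"
        using agree_trans[of s1 c1 c2 "max s1 s2" c'] 2(1) that(1) by (auto simp: agree_def)
      then show ?thesis
        using 1(2) True killed_mono by (metis max.cobounded1)
    next
      case False
      then have "A \<in> (\<Union>i\<in>I. AA i)"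
        using that by blast
      moreover have "agree s2 c2 c'"
        using that(1) by (auto simp: agree_def)
      ultimately show ?thesis
        using 2(2) killed_mono by (metis max.cobounded2)
    qed
    moreover have "agree s c c2"
      using agree_trans[OF 1(1) 2(1)] by simp
    ultimately show "\<exists>c' s'. agree s c c' \<and> (\<forall>c''. agree s' c' c'' \<longrightarrow>
        (\<forall>A\<in>\<Union>i\<in>insert i I. AA i. killed \<Psi> m c'' A s'))"
      by blast
  qed
qed

text \<open>
  A state records for each class \<open>j\<close> a finite set \<open>E j\<close> and elements \<open>V j\<close> forced into the output by
  \<open>E j\<close>.  Once \<open>V j\<close> has two elements, the pair of its minimum and maximum has a color, and from stage
  \<open>s\<close> on the new coloring gives the opposite color to \<open>(u, z)\<close> for \<open>u \<in> V j\<close>; disjointness of the \<open>V j\<close>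
  makes these demands compatible.  Some class of any partition is infinite, so by compactness every
  partition soon forces a new \<open>z\<close> into the output of some extension of some \<open>E j\<close>: it is then killed,
  or else \<open>V j\<close> grows.  Hence the induction on the total number of missing elements.
\<close>

lemma good_states:
  fixes \<Psi> :: "nat set \<Rightarrow> nat \<Rightarrow> nat option" and k :: nat
  assumes continuous: "\<And>X x y. \<Psi> X x = Some y \<Longrightarrow> \<exists>t. \<forall>X'. X' \<inter> {..<t} = X \<inter> {..<t} \<longrightarrow> \<Psi> X' x = Some y"
    and Y: "infinite Y" "Y \<subseteq> {m..}"
    and hereditary: "\<And>L. infinite L \<Longrightarrow> L \<subseteq> Y \<Longrightarrow> \<exists>H. infinite H \<and> \<Psi> L = (\<lambda>n. Some (char_fun H n))"
    and E: "\<And>j. E j \<subseteq> Y \<inter> {..<t}" and V: "\<And>j. V j \<subseteq> {..<t}" "\<And>i j. i \<noteq> j \<Longrightarrow> V i \<inter> V j = {}"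
    and EV: "\<And>j x. j < k \<Longrightarrow> x \<in> V j \<Longrightarrow> forces \<Psi> t (E j) x"
  shows "good \<Psi> m {A. (\<forall>x. A x < k) \<and> (\<forall>j<k. \<forall>a\<in>E j. A a = j)}"
  using E V EV
proof (induction "\<Sum>j<k. 2 - card (V j)" arbitrary: E V t rule: less_induct)
  case less
  note E = less.prems(1) and V = less.prems(2,3) and EV = less.prems(4)
  have fin_V: "finite (V j)" for j
    using V(1) finite_subset by blast
  show ?case
    unfolding good_def
  proof (intro allI)
    fix c :: "nat \<Rightarrow> nat \<Rightarrow> bool" and s0
    define s where "s = max t s0"
    \<comment> \<open>When \<open>V j\<close> is a singleton, its minimum and maximum coincide and
      the prescribed color is meaningless; it is relied on only when \<open>V j\<close> has at least
      two elements.\<close>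
    define c' where "c' u v = (if v < s then c u v else \<exists>j<k. u \<in> V j \<and> \<not> c (Min (V j)) (Max (V j)))" for u v
    have agree': "agree s0 c c'"
      by (auto simp: agree_def c'_def s_def)
    \<comment> \<open>The bound \<open>s \<le> z\<close> makes \<open>z\<close> new and puts its
      pairs with \<open>V j\<close> under the new rule; keeping \<open>F\<close> inside
      \<open>Y\<close> lets the enlarged \<open>E j\<close> serve again in the induction.\<close>
    define P where "P n A \<longleftrightarrow> (\<exists>j<k. \<exists>z F. s \<le> z \<and> z < n \<and> F \<subseteq> {a \<in> Y. s \<le> a \<and> a < n \<and> A a = j}
        \<and> forces \<Psi> n (E j \<union> F) z)" for n A
    have "\<exists>n. \<forall>A. (\<forall>i. A i < k) \<longrightarrow> P n A"
    proof (rule konig_compactness)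
      fix n n' :: nat and A
      assume "P n A" "n \<le> n'"
      then obtain j z F where *: "j < k" "s \<le> z" "z < n" "F \<subseteq> {a \<in> Y. s \<le> a \<and> a < n \<and> A a = j}"
          "forces \<Psi> n (E j \<union> F) z"
        unfolding P_def by blast
      have "t < n"
        using *(2,3) by (simp add: s_def)
      then have "E j \<union> F \<subseteq> {..<n}"
        using *(4) E[of j] by fastforce
      then have "forces \<Psi> n' (E j \<union> F) z"
        using forces_extend[OF *(5), of n' "{}"] \<open>n \<le> n'\<close> by simp
      moreover have "F \<subseteq> {a \<in> Y. s \<le> a \<and> a < n' \<and> A a = j}"
        using *(4) \<open>n \<le> n'\<close> by auto
      moreover have "z < n'"
        using *(3) \<open>n \<le> n'\<close> by simp
      ultimately show "P n' A"
        unfolding P_def using *(1,2) by blast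
    next
      fix n :: nat and A B :: "nat \<Rightarrow> nat"
      assume P: "P n A" and eq: "\<forall>i<n. A i = B i"
      have "{a \<in> Y. s \<le> a \<and> a < n \<and> A a = j} = {a \<in> Y. s \<le> a \<and> a < n \<and> B a = j}" for j
        using eq by auto
      then show "P n B"
        using P unfolding P_def by simp
    next
      fix A :: "nat \<Rightarrow> nat"
      assume A: "\<forall>i. A i < k"
      have "finite (A ` Y)"
        using A by (intro finite_subset[of "A ` Y" "{..<k}"] image_subsetI) simp_all
      then obtain j where j: "j \<in> A ` Y" "infinite {a \<in> Y. A a = j}"
        using pigeonhole_infinite[OF Y(1)] by blast
      \<comment> \<open>The partition \<open>A\<close> need not respect \<open>E\<close> here.
        \<open>L\<close> is an infinite subset of \<open>Y\<close>, so its output contains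
        arbitrarily large \<open>z\<close>, and continuity reduces the membership of one such
        \<open>z\<close> to a finite part of \<open>L\<close>.\<close>
      define L where "L = E j \<union> {a \<in> Y. s \<le> a \<and> A a = j}"
      have "{a \<in> Y. A a = j} \<subseteq> {a \<in> Y. s \<le> a \<and> A a = j} \<union> {..<s}"
        by auto
      then have "infinite L"
        unfolding L_def using j(2) by (meson finite_Un finite_lessThan finite_subset)
      moreover have "L \<subseteq> Y"
        using E by (auto simp: L_def)
      ultimately obtain H where H: "infinite H" "\<Psi> L = (\<lambda>n. Some (char_fun H n))"
        using hereditary by blast
      obtain z where z: "z \<in> H" "s < z"
        using H(1) infinite_nat_iff_unbounded by blast
      then have "\<Psi> L z = Some 1"
        using H(2) by (simp add: char_fun_def)
      then obtain n0 where n0: "\<And>X. X \<inter> {..<n0} = L \<inter> {..<n0} \<Longrightarrow> \<Psi> X z = Some 1"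
        using continuous by blast
      define n where "n = max n0 (Suc z)"
      define F where "F = {a \<in> Y. s \<le> a \<and> a < n \<and> A a = j}"
      have "t < n"
        using z(2) by (auto simp: n_def s_def)
      then have EF: "E j \<union> F = L \<inter> {..<n}"
        using E[of j] by (fastforce simp: F_def L_def)
      have "forces \<Psi> n (E j \<union> F) z"
        unfolding forces_def EF
      proof (intro allI impI n0)
        fix X
        assume "X \<inter> {..<n} = L \<inter> {..<n}"
        moreover have "{..<n0} = {..<n} \<inter> {..<n0}"
          by (auto simp: n_def)
        ultimately show "X \<inter> {..<n0} = L \<inter> {..<n0}"
          by (metis Int_assoc)
      qed
      moreover have "j < k" "z < n"
        using j(1) A by (auto simp: n_def)
      ultimately have "P n A"
        unfolding P_def using z(2)
        by (intro exI[of _ j] exI[of _ z] exI[of _ F] conjI) (simp_all add: F_def)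
      then show "\<exists>n. P n A" ..
    qed
    then obtain n where n: "\<And>A. \<forall>i. A i < k \<Longrightarrow> P n A"
      by blast
    \<comment> \<open>These are the finitely many ways in which the state can gain a missing
      element. The induction hypothesis handles each of them, and \<open>good_UN\<close> combines
      the results.\<close>
    define I where "I = {(j, z, F). j < k \<and> card (V j) < 2 \<and> s \<le> z \<and> z < n \<and> F \<subseteq> Y \<inter> {s..<n}
        \<and> forces \<Psi> n (E j \<union> F) z}"
    define AA where "AA = (\<lambda>(j, z :: nat, F). {A. (\<forall>x. A x < k) \<and> (\<forall>i<k. \<forall>a\<in>(E(j := E j \<union> F)) i. A a = i)})"
    have "finite I"
      by (rule finite_subset[of _ "{..<k} \<times> {..<n} \<times> Pow {..<n}"]) (auto simp: I_def)
    moreover have "good \<Psi> m (AA i)" if i: "i \<in> I" for i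
    proof -
      obtain j z F where ijz: "i = (j, z, F)"
        by (cases i) auto
      with i have I: "j < k" "card (V j) < 2" "s \<le> z" "z < n" "F \<subseteq> Y \<inter> {s..<n}" "forces \<Psi> n (E j \<union> F) z"
        by (auto simp: I_def)
      let ?E = "E(j := E j \<union> F)" and ?V = "V(j := insert z (V j))"
      have tn: "t \<le> s" "s < n" "t \<le> n"
        using I(3,4) by (auto simp: s_def)
      have z: "z \<notin> V i" for i
        using V(1)[of i] I(3) tn(1) by auto
      have "good \<Psi> m {A. (\<forall>x. A x < k) \<and> (\<forall>i<k. \<forall>a\<in>?E i. A a = i)}"
      proof (rule less.hyps[of ?V])
        have "(\<Sum>i<k. 2 - card (?V i)) < (\<Sum>i<k. 2 - card (V i))"
        proof (rule sum_strict_mono_ex1)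
          show "\<exists>a\<in>{..<k}. 2 - card (?V a) < 2 - card (V a)"
            using I(1,2) z[of j] fin_V by (intro bexI[of _ j]) auto
        qed (use z fin_V in auto)
        then show "(\<Sum>i<k. 2 - card (?V i)) < (\<Sum>i<k. 2 - card (V i))" .
        show "?E i \<subseteq> Y \<inter> {..<n}" for i
          using E[of i] I(5) tn by (auto simp: subset_iff)
        show "?V i \<subseteq> {..<n}" for i
          using V(1)[of i] I(4) tn by (auto simp: subset_iff)
        show "?V i \<inter> ?V i' = {}" if "i \<noteq> i'" for i i'
          using V(2)[OF that] z that by auto
        show "forces \<Psi> n (?E i) x" if "i < k" "x \<in> ?V i" for i x
        proof (cases "i = j \<and> x = z")
          case True
          then show ?thesis
            using I(6) by simp
        next
          case False
          then have "x \<in> V i"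
            using that by (auto split: if_splits)
          from EV[OF that(1) this] have "forces \<Psi> n (E i \<union> (if i = j then F else {})) x"
            by (rule forces_extend) (use E[of i] I(5) tn in \<open>auto simp: subset_iff\<close>)
          then show ?thesis
            by (auto split: if_splits)
        qed
      qed
      then show ?thesis
        by (simp add: ijz AA_def)
    qed
    ultimately have "good \<Psi> m (\<Union>i\<in>I. AA i)"
      using good_UN by blast
    then obtain c2 s2 where c2': "agree (max s n) c' c2"
      and c2: "\<And>c'' A. agree s2 c2 c'' \<Longrightarrow> A \<in> (\<Union>i\<in>I. AA i) \<Longrightarrow> killed \<Psi> m c'' A s2"
      unfolding good_def by metis
    have "killed \<Psi> m c'' A (max n s2)"
      if c'': "agree (max n s2) c2 c''" and A: "\<forall>x. A x < k" "\<forall>j<k. \<forall>a\<in>E j. A a = j" for c'' A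
    proof -
      obtain j z F where *: "j < k" "s \<le> z" "z < n" "F \<subseteq> {a \<in> Y. s \<le> a \<and> a < n \<and> A a = j}"
          "forces \<Psi> n (E j \<union> F) z"
        using n[OF A(1)] unfolding P_def by blast
      have tn: "t \<le> s" "s < n" "t \<le> n"
        using *(2,3) by (auto simp: s_def)
      show ?thesis
      \<comment> \<open>If \<open>V j\<close> still lacks an element, \<open>A\<close> is compatible
        with one of the enlarged states and hence already killed. Otherwise the pairs
        \<open>(x, y)\<close> and \<open>(x, z)\<close> get different colors, and
        \<open>E j \<union> F\<close> forces all three numbers into the output.\<close>
      proof (cases "card (V j) < 2")
        case True
        then have "(j, z, F) \<in> I"
          using * by (auto simp: I_def)
        moreover have "A \<in> AA (j, z, F)"
          using A *(4) by (auto simp: AA_def)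
        moreover have "agree s2 c2 c''"
          using c'' by (auto simp: agree_def)
        ultimately show ?thesis
          using c2 killed_mono by (metis UN_I max.cobounded2)
      next
        case False
        define x y where "x = Min (V j)" and "y = Max (V j)"
        have ne: "V j \<noteq> {}"
          using False by auto
        then have xy: "x \<in> V j" "y \<in> V j"
          using fin_V by (auto simp: x_def y_def)
        then have lt: "x < t" "y < t"
          using V(1) by auto
        have "x \<noteq> y"
        proof
          assume "x = y"
          then have "V j = {x}"
            using fin_V[of j] ne unfolding x_def y_def
            by (metis Max_ge Min_le antisym is_singletonI' is_singleton_the_elem singletonD singletonI xy(1) x_def)
          then show False
            using False by simp
        qed
        then have "x < y"
          using xy fin_V by (metis Min_le le_neq_implies_less x_def)
        have c''_eq: "c'' u v = c' u v" if "u < v" "v < n" for u v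
          using that c2' c'' by (auto simp: agree_def)
        have "c'' x y = c x y"
          using c''_eq[OF \<open>x < y\<close>] lt tn by (simp add: c'_def)
        moreover have "c'' x z = (\<not> c x y)"
        proof -
          \<comment> \<open>Disjointness leaves \<open>j\<close> as the only class that can decide
            the color \<open>c' x z\<close>.\<close>
          have "i = j" if "x \<in> V i" for i
            using V(2)[of i j] that xy(1) by blast
          then have "c' x z = (\<not> c x y)"
            using *(1,2) xy(1) by (auto simp: c'_def x_def y_def)
          then show ?thesis
            using c''_eq[of x z] lt tn *(2,3) by simp
        qed
        ultimately have "c'' x y \<noteq> c'' x z"
          by simp
        moreover have "forces \<Psi> n (E j \<union> F) w" if "w \<in> V j" for w
          by (rule forces_extend[OF EV[OF *(1) that]]) (use E[of j] *(4) tn in \<open>auto simp: subset_iff\<close>)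
        moreover have "E j \<union> F \<subseteq> {a. m \<le> a \<and> a < n \<and> A a = j}"
          using E[of j] *(1,4) tn A(2) Y(2) by (auto simp: subset_iff)
        ultimately have "killed \<Psi> m c'' A n"
          using \<open>x < y\<close> lt tn *(2,3,5) xy by (intro killedI[of "E j \<union> F" m n A j x y x z]) auto
        then show ?thesis
          using killed_mono by (metis max.cobounded1)
      qed
    qed
    moreover have "agree s0 c c2"
      using agree_trans[OF agree' c2'] by (simp add: s_def)
    ultimately show "\<exists>c' s'. agree s0 c c' \<and> (\<forall>c''. agree s' c' c'' \<longrightarrow>
        (\<forall>A\<in>{A. (\<forall>x. A x < k) \<and> (\<forall>j<k. \<forall>a\<in>E j. A a = j)}. killed \<Psi> m c'' A s'))"
      by blast
  qed
qed

section \<open>The computable coloring\<close>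

text \<open>Via digits, a bounded number quantifier ranges over all partitions of
  \<open>{..<t}\<close>. In the induction the new value becomes the leading digit, which leaves the
  lower digits unchanged.\<close>

lemma ex_digits:
  fixes A :: "nat \<Rightarrow> nat"
  assumes "\<And>i. A i < b"
  shows "\<exists>a<b ^ t. \<forall>i<t. a div b ^ i mod b = A i"
proof (induction t)
  case 0
  then show ?case
    by simp
next
  case (Suc t)
  then obtain a where a: "a < b ^ t" "\<forall>i<t. a div b ^ i mod b = A i"
    by blast
  have b: "b > 0"
    using assms[of 0] by simp
  have "a + A t * b ^ t < b ^ t + A t * b ^ t"
    using a(1) by simp
  also have "\<dots> = Suc (A t) * b ^ t"
    by simp
  also have "\<dots> \<le> b * b ^ t"
    using assms[of t] by (intro mult_right_mono) auto
  finally have "a + A t * b ^ t < b ^ Suc t"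
    by simp
  moreover have "(a + A t * b ^ t) div b ^ i mod b = A i" if "i < Suc t" for i
  proof (cases "i = t")
    case True
    then show ?thesis
      using a(1) assms[of t] b by simp
  next
    case False
    then have i: "i < t"
      using that by simp
    then have "b ^ t = b ^ i * (b * b ^ (t - Suc i))"
      by (metis Suc_diff_Suc add_diff_inverse_nat less_imp_not_less power_Suc power_add)
    then have "(a + A t * b ^ t) div b ^ i = (a + b ^ i * (A t * b * b ^ (t - Suc i))) div b ^ i"
      by (simp add: algebra_simps)
    also have "\<dots> = A t * b * b ^ (t - Suc i) + a div b ^ i"
      by (rule div_mult_self2) (use b in simp)
    finally show ?thesis
      using a(2) i by (simp add: mult.assoc mult.left_commute[of "A t" b])
  qed
  ultimately show ?case
    by blast
qed

text \<open>This and the next lemma give the exact bound for a quantifier over codes of subsets of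
  \<open>{..<t}\<close>.\<close>

lemma set_encode_less:
  assumes "S \<subseteq> {..<t}"
  shows "set_encode S < 2 ^ t"
proof -
  have "set_encode S \<le> (\<Sum>i<t. 2 ^ i)"
    unfolding set_encode_def using assms by (intro sum_mono2) auto
  also have "\<dots> < 2 ^ t"
    by (induction t) auto
  finally show ?thesis .
qed

lemma set_decode_subset: "e < 2 ^ t \<Longrightarrow> set_decode e \<subseteq> {..<t}"
proof
  fix i
  assume e: "e < 2 ^ t" and i: "i \<in> set_decode e"
  have "e div 2 ^ i = 0" if "t \<le> i"
    using e that by (meson div_less le_trans not_le one_le_numeral power_increasing)
  then show "i \<in> {..<t}"
    using i by (cases "t \<le> i") (auto simp: set_decode_def)
qed

text \<open>Colorings of finitely many pairs are coded by the binary digits of a number \<open>w\<close>.\<close>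

definition pair_bit :: "nat \<Rightarrow> nat \<Rightarrow> nat \<Rightarrow> bool" where
  "pair_bit w u v \<longleftrightarrow> odd (w div 2 ^ prod_encode (u, v))"

definition code_coloring :: "nat \<Rightarrow> (nat \<Rightarrow> nat \<Rightarrow> bool) \<Rightarrow> nat" where
  "code_coloring t c = set_encode (prod_encode ` {(u, v). u < v \<and> v < t \<and> c u v})"

lemma pair_bit_code_coloring:
  assumes "u < v" "v < t"
  shows "pair_bit (code_coloring t c) u v = c u v"
proof -
  have "finite {(u, v). u < v \<and> v < t \<and> c u v}"
    by (rule finite_subset[of _ "{..<t} \<times> {..<t}"]) auto
  then have "set_decode (code_coloring t c) = prod_encode ` {(u, v). u < v \<and> v < t \<and> c u v}"
    unfolding code_coloring_def by simp
  moreover have "pair_bit (code_coloring t c) u v \<longleftrightarrow> prod_encode (u, v) \<in> set_decode (code_coloring t c)"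
    by (simp add: pair_bit_def set_decode_def)
  ultimately show ?thesis
    using assms by (auto simp: image_iff)
qed

text \<open>
  The base \<open>k\<close> digits of \<open>a\<close> are a partition of \<open>{..<t}\<close> into \<open>k\<close> classes, and the binary digits of \<open>e\<close>
  are a finite subset of one of them.
\<close>

definition wins :: "(nat \<Rightarrow> nat \<Rightarrow> nat list \<Rightarrow> nat) \<Rightarrow> nat \<Rightarrow> nat \<Rightarrow> nat \<Rightarrow> nat \<Rightarrow> bool" where
  "wins g k s w t \<longleftrightarrow> (\<forall>a<k ^ t. \<exists>e<2 ^ t.
     (\<forall>i<s. \<not> odd (e div 2 ^ i)) \<and>
     (\<exists>j<k. \<forall>i<t. odd (e div 2 ^ i) \<longrightarrow> a div k ^ i mod k = j) \<and>
     (\<exists>v<t. \<exists>u<v. \<exists>y<t. \<exists>x<y. g t e [u] = 2 \<and> g t e [v] = 2 \<and> g t e [x] = 2 \<and> g t e [y] = 2 \<and>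
        \<not> (pair_bit w u v \<longleftrightarrow> pair_bit w x y)))"

text \<open>Both \<open>r\<close> and \<open>q\<close> code a pair of a stage \<open>s\<close> and a coloring of the pairs below \<open>s\<close>.\<close>

definition extends :: "(nat \<Rightarrow> nat \<Rightarrow> nat list \<Rightarrow> nat) \<Rightarrow> nat \<Rightarrow> nat \<Rightarrow> nat \<Rightarrow> bool" where
  "extends g K r q \<longleftrightarrow> fst (prod_decode r) < fst (prod_decode q) \<and>
     (\<forall>v<fst (prod_decode r). \<forall>u<v. pair_bit (snd (prod_decode r)) u v \<longleftrightarrow> pair_bit (snd (prod_decode q)) u v) \<and>
     wins g (Suc K) (fst (prod_decode r)) (snd (prod_decode q)) (fst (prod_decode q))"

text \<open>The start 0 decodes to the pair \<open>(0, 0)\<close>, so nothing is colored at first.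
  The step from \<open>K\<close> to \<open>K + 1\<close> defeats the partitions into
  \<open>K + 1\<close> classes, and \<open>LEAST\<close> turns the choice of an extension into a
  search.\<close>

definition stage :: "(nat \<Rightarrow> nat \<Rightarrow> nat list \<Rightarrow> nat) \<Rightarrow> nat \<Rightarrow> nat" where
  "stage g = rec_nat 0 (\<lambda>K r. LEAST q. extends g K r q)"

lemma recp_pair_bit: "recf n f \<Longrightarrow> recf n g \<Longrightarrow> recf n h \<Longrightarrow> recp n (\<lambda>v. pair_bit (f v) (g v) (h v))"
  unfolding pair_bit_def by (intro rec_intros recf_prod_encode)

text \<open>All quantifiers in \<open>wins\<close> and \<open>extends\<close> are bounded by
  computable terms, and \<open>g\<close> is total and computable.\<close>

lemma recp_extends:
  assumes g: "approximates p 1 g" and "recf n a" "recf n b" "recf n c"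
  shows "recp n (\<lambda>v. extends g (a v) (b v) (c v))"
proof -
  have g': "recf n (\<lambda>v. g (f v) (h v) [l v])" if "recf n f" "recf n h" "recf n l" for n f h l
    using approximates_recf[OF g that(1,2), of "\<lambda>_. l"] that(3) by simp
  have "recp (Suc (Suc (Suc 0))) (\<lambda>v. extends g (v 0) (v (Suc 0)) (v (Suc (Suc 0))))"
    unfolding extends_def wins_def
    by (intro rec_intros recp_pair_bit g' recf_fst_prod_decode recf_snd_prod_decode) simp_all
  then show ?thesis
    using recf_subst3[where h = "\<lambda>x y z. of_bool (extends g x y z)"] assms(2-)
    by (simp add: recp_def numeral_3_eq_3)
qed

lemma recf_stage:
  assumes g: "approximates p 1 g" and ex: "\<And>K r. \<exists>q. extends g K r q" and f: "recf n f"
  shows "recf n (\<lambda>v. stage g (f v))"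
  unfolding stage_def
  by (intro recf_rec_nat recf_const recf_Least f recp_extends[OF g] recf_var ex) simp_all

text \<open>This passes from forcing, which quantifies over all oracles, to convergence seen by
  \<open>g\<close>. Only finitely many pairs \<open>(E, x)\<close> lie below \<open>s'\<close>, so
  one stage \<open>t\<close> sees every forced membership among them; the witness codes
  \<open>t\<close> together with the part of \<open>c\<close> below \<open>t\<close>.\<close>

lemma ex_extends:
  fixes \<Psi> :: "nat set \<Rightarrow> nat \<Rightarrow> nat option"
  assumes g: "approximates p 1 g" and \<Psi>: "\<And>X n. \<Psi> X n = run p X [n]"
    and c: "agree s (pair_bit (snd (prod_decode r))) c" and s: "s = fst (prod_decode r)"
    and kill: "\<And>A. (\<And>x. A x < Suc K) \<Longrightarrow> killed \<Psi> s c A s'"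
  shows "\<exists>q. extends g K r q"
proof -
  let ?k = "Suc K"
  have ev: "\<forall>\<^sub>F t in sequentially. \<forall>e. E \<inter> {..<t} = set_decode e \<inter> {..<t} \<longrightarrow> g t e [x] = 2"
    if "forces \<Psi> s' E x" "E \<subseteq> {..<s'}" for E x
  proof -
    have "run p E [x] = Some 1"
      using that by (auto simp: forces_def \<Psi>[symmetric])
    from approximatesD(2)[OF g _ this] show ?thesis
      by (simp add: numeral_2_eq_2)
  qed
  have "\<forall>\<^sub>F t in sequentially. \<forall>(E, x)\<in>{(E, x). E \<subseteq> {..<s'} \<and> x < s' \<and> forces \<Psi> s' E x}.
      \<forall>e. E \<inter> {..<t} = set_decode e \<inter> {..<t} \<longrightarrow> g t e [x] = 2"
  proof (rule eventually_ball_finite)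
    show "finite {(E, x). E \<subseteq> {..<s'} \<and> x < s' \<and> forces \<Psi> s' E x}"
      by (rule finite_subset[of _ "Pow {..<s'} \<times> {..<s'}"]) auto
  qed (use ev in auto)
  then have "\<forall>\<^sub>F t in sequentially. s < t \<and> s' \<le> t \<and>
      (\<forall>(E, x)\<in>{(E, x). E \<subseteq> {..<s'} \<and> x < s' \<and> forces \<Psi> s' E x}.
      \<forall>e. E \<inter> {..<t} = set_decode e \<inter> {..<t} \<longrightarrow> g t e [x] = 2)"
    by (intro eventually_conj eventually_gt_at_top eventually_ge_at_top)
  from eventually_happens'[OF sequentially_bot this] obtain t where t: "s < t" "s' \<le> t"
      "\<forall>(E, x)\<in>{(E, x). E \<subseteq> {..<s'} \<and> x < s' \<and> forces \<Psi> s' E x}.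
      \<forall>e. E \<inter> {..<t} = set_decode e \<inter> {..<t} \<longrightarrow> g t e [x] = 2"
    by (elim exE conjE)
  have t': "g t e [x] = 2" if "E \<subseteq> {..<s'}" "x < s'" "forces \<Psi> s' E x"
      "E \<inter> {..<t} = set_decode e \<inter> {..<t}" for E x e
    using bspec[OF t(3), of "(E, x)"] that by simp
  let ?w = "code_coloring t c"
  have "wins g ?k s ?w t"
    unfolding wins_def
  proof (intro allI impI)
    fix a :: nat
    \<comment> \<open>The digit formula makes sense for all \<open>i\<close>, so \<open>a\<close>
      yields a partition of all natural numbers, as \<open>kill\<close> requires.\<close>
    define A where "A i = a div ?k ^ i mod ?k" for i
    have A: "A i < ?k" for i
      by (simp add: A_def)
    obtain E j u v x y where *: "E \<subseteq> {i. s \<le> i \<and> i < s' \<and> A i = j}" "u < v" "v < s'" "x < y" "y < s'"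
        "\<forall>z\<in>{u, v, x, y}. forces \<Psi> s' E z" "c u v \<noteq> c x y"
      using kill[of A, OF A] unfolding killed_def by blast
    define e where "e = set_encode E"
    have E: "E \<subseteq> {..<s'}" "E \<subseteq> {..<t}"
      using *(1) t(2) by auto
    then have e: "set_decode e = E"
      using finite_subset[OF E(2)] by (simp add: e_def)
    then have bit: "odd (e div 2 ^ i) \<longleftrightarrow> i \<in> E" for i
      by (auto simp: set_decode_def)
    have "e < 2 ^ t"
      unfolding e_def by (rule set_encode_less[OF E(2)])
    moreover have "\<forall>i<s. \<not> odd (e div 2 ^ i)"
      unfolding bit using *(1) by auto
    moreover have "\<exists>j<?k. \<forall>i<t. odd (e div 2 ^ i) \<longrightarrow> a div ?k ^ i mod ?k = j"
    \<comment> \<open>Only a nonempty \<open>E\<close> ties the class \<open>j\<close> of the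
      killing set to a value of \<open>A\<close>; for empty \<open>E\<close> any color will
      do.\<close>
    proof (cases "E = {}")
      case True
      then show ?thesis
        unfolding bit by auto
    next
      case False
      then have "j < ?k"
        using *(1) A by auto
      moreover have "\<forall>i<t. i \<in> E \<longrightarrow> a div ?k ^ i mod ?k = j"
        using *(1) by (auto simp: A_def)
      ultimately show ?thesis
        unfolding bit by blast
    qed
    moreover have "\<exists>v<t. \<exists>u<v. \<exists>y<t. \<exists>x<y. g t e [u] = 2 \<and> g t e [v] = 2 \<and> g t e [x] = 2 \<and> g t e [y] = 2 \<and>
        \<not> (pair_bit ?w u v \<longleftrightarrow> pair_bit ?w x y)"
    proof -
      have "g t e [z] = 2" if "z \<in> {u, v, x, y}" for z
        using t'[OF E(1), of z e] e that *(2-6) by auto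
      moreover have "\<not> (pair_bit ?w u v \<longleftrightarrow> pair_bit ?w x y)"
        using pair_bit_code_coloring[of _ _ t c] * t(2) by simp
      moreover have "v < t" "y < t"
        using * t(2) by auto
      ultimately show ?thesis
        using *(2,4) by (metis insertCI)
    qed
    ultimately show "\<exists>e<2 ^ t. (\<forall>i<s. \<not> odd (e div 2 ^ i)) \<and>
        (\<exists>j<?k. \<forall>i<t. odd (e div 2 ^ i) \<longrightarrow> a div ?k ^ i mod ?k = j) \<and>
        (\<exists>v<t. \<exists>u<v. \<exists>y<t. \<exists>x<y. g t e [u] = 2 \<and> g t e [v] = 2 \<and> g t e [x] = 2 \<and> g t e [y] = 2 \<and>
        \<not> (pair_bit ?w u v \<longleftrightarrow> pair_bit ?w x y))"
      by blast
  qed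
  moreover have "\<forall>v<s. \<forall>u<v. pair_bit (snd (prod_decode r)) u v \<longleftrightarrow> pair_bit ?w u v"
    using c t(1) pair_bit_code_coloring[of _ _ t c] by (auto simp: agree_def)
  ultimately have "extends g K r (prod_encode (t, ?w))"
    using t(1) by (simp add: extends_def s)
  then show ?thesis ..
qed

section \<open>Limit color classes\<close>

lemma stable_coloring_limit:
  assumes "stable_coloring k d"
  obtains A where "\<And>x. A x < k" "\<And>x. (\<lambda>y. d {x, y}) \<longlonglongrightarrow> A x"
proof -
  have "\<forall>x. \<exists>j<k. (\<lambda>y. d {x, y}) \<longlonglongrightarrow> j"
  proof
    fix x
    obtain j where j: "(\<lambda>y. d {x, y}) \<longlonglongrightarrow> j"
      using assms unfolding stable_coloring_def by blast
    then have "\<forall>\<^sub>F y in sequentially. d {x, y} = j"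
      by (simp add: tendsto_discrete)
    then have "\<forall>\<^sub>F y in sequentially. d {x, y} = j \<and> x < y"
      using eventually_gt_at_top[of x] by (rule eventually_conj)
    \<comment> \<open>Requiring \<open>x < y\<close> makes \<open>{x, y}\<close> a genuine pair;
      only on such pairs is \<open>d\<close> known to be below \<open>k\<close>.\<close>
    then obtain y where y: "d {x, y} = j" "x < y"
      using eventually_happens'[OF sequentially_bot] by fast
    then have "{x, y} \<in> nsets UNIV 2"
      by (auto simp: nsets_def)
    then have "j < k"
      using assms y(1) unfolding stable_coloring_def coloring_def by blast
    with j show "\<exists>j<k. (\<lambda>y. d {x, y}) \<longlonglongrightarrow> j"
      by blast
  qed
  then show ?thesis
    using that by metis
qed

lemma infinite_color_class:
  fixes A :: "nat \<Rightarrow> nat"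
  assumes "\<And>x. A x < k"
  shows "\<exists>j<k. infinite {x. A x = j}"
proof -
  have "finite (range A)"
    using assms by (intro finite_subset[of "range A" "{..<k}"]) auto
  then show ?thesis
    using pigeonhole_infinite[of UNIV A] assms by auto
qed

text \<open>Only finitely many classes occur, so the union of the finite ones is bounded. A nonempty
  finite set above the bound and inside one class can therefore be continued to an infinite subset
  of that class.\<close>

lemma finite_color_classes_bounded:
  fixes A :: "nat \<Rightarrow> nat"
  assumes "\<And>x. A x < k"
  obtains m where "\<And>x. m \<le> x \<Longrightarrow> infinite {y. A y = A x}"
proof -
  have "finite (\<Union>j\<in>{j. j < k \<and> finite {x. A x = j}}. {x. A x = j})"
    by auto
  then obtain m where m: "\<And>x. x \<in> (\<Union>j\<in>{j. j < k \<and> finite {x. A x = j}}. {x. A x = j}) \<Longrightarrow> x < m"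
    using finite_nat_bounded by (metis lessThan_iff subsetD)
  have "infinite {y. A y = A x}" if "m \<le> x" for x
    using m[of x] that assms[of x] by auto
  then show ?thesis
    by (rule that)
qed

theorem theorem3p2:
  fixes \<Psi> :: "nat set \<Rightarrow> nat \<Rightarrow> nat option"
  assumes "turing_functional \<Psi>"
  shows "\<exists>c :: nat set \<Rightarrow> nat. coloring 2 c \<and> computable_coloring c \<and>
           (\<forall>k\<ge>2. \<forall>d :: nat set \<Rightarrow> nat. stable_coloring k d \<longrightarrow>
              (\<exists>L. infinite L \<and> limit_homogeneous k d L \<and>
                   \<not> (\<exists>H. infinite H \<and> homogeneous c H \<and>
                          \<Psi> L = (\<lambda>n. Some (char_fun H n)))))"
proof (cases "\<exists>Y. infinite Y \<and> (\<forall>L. infinite L \<longrightarrow> L \<subseteq> Y \<longrightarrow>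
    (\<exists>H. infinite H \<and> \<Psi> L = (\<lambda>n. Some (char_fun H n))))")
  case False
  have "coloring 2 (\<lambda>_. 0)"
    by (simp add: coloring_def)
  moreover have "computable_coloring (\<lambda>_. 0)"
    unfolding computable_coloring_def by (rule exI[of _ Zero]) simp
  moreover have "\<exists>L. infinite L \<and> limit_homogeneous k d L \<and>
      \<not> (\<exists>H. infinite H \<and> homogeneous (\<lambda>_. 0 :: nat) H \<and> \<Psi> L = (\<lambda>n. Some (char_fun H n)))"
    if stable: "stable_coloring k d" for k and d :: "nat set \<Rightarrow> nat"
  proof -
    obtain A where A: "\<And>x. A x < k" "\<And>x. (\<lambda>y. d {x, y}) \<longlonglongrightarrow> A x"
      using stable_coloring_limit[OF stable] by blast
    obtain j where j: "j < k" "infinite {x. A x = j}"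
      using infinite_color_class A(1) by blast
    then obtain L where "infinite L" "L \<subseteq> {x. A x = j}"
        "\<not> (\<exists>H. infinite H \<and> \<Psi> L = (\<lambda>n. Some (char_fun H n)))"
      using False by blast
    moreover from this have "limit_homogeneous k d L"
      using j(1) A(2) unfolding limit_homogeneous_def by blast
    ultimately show ?thesis
      by blast
  qed
  ultimately show ?thesis
    by blast
next
  case True
  then obtain Y where Y: "infinite Y" and hereditary: "\<And>L. infinite L \<Longrightarrow> L \<subseteq> Y \<Longrightarrow>
      \<exists>H. infinite H \<and> \<Psi> L = (\<lambda>n. Some (char_fun H n))"
    by blast
  obtain p where \<Psi>: "\<And>X n. \<Psi> X n = run p X [n]"
    using assms unfolding turing_functional_def by blast
  obtain g where g: "approximates p 1 g"
    using ex_approximates by blast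
  \<comment> \<open>A stage at which \<open>g\<close> sees convergence bounds the use: by soundness
    of \<open>g\<close> every oracle with the same part below that stage gives the same
    value.\<close>
  have continuous: "\<exists>t. \<forall>X'. X' \<inter> {..<t} = X \<inter> {..<t} \<longrightarrow> \<Psi> X' x = Some y" if "\<Psi> X x = Some y" for X x y
  proof -
    have "\<forall>\<^sub>F t in sequentially. \<forall>e. X \<inter> {..<t} = set_decode e \<inter> {..<t} \<longrightarrow> g t e [x] = Suc y"
      using approximatesD(2)[OF g] that by (simp add: \<Psi>)
    from eventually_happens'[OF sequentially_bot this]
    obtain t where t: "\<And>e. X \<inter> {..<t} = set_decode e \<inter> {..<t} \<Longrightarrow> g t e [x] = Suc y"
      by blast
    define e where "e = set_encode (X \<inter> {..<t})"
    have "X \<inter> {..<t} = set_decode e \<inter> {..<t}"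
      by (simp add: e_def)
    then show ?thesis
      using approximatesD(1)[OF g _ t] \<Psi> by (metis length_Cons list.size(3) One_nat_def)
  qed
  have ex: "\<exists>q. extends g K r q" for K r
  proof -
    define s where "s = fst (prod_decode r)"
    have "Y \<subseteq> (Y \<inter> {s..}) \<union> {..<s}"
      by auto
    then have "infinite (Y \<inter> {s..})"
      using Y by (meson finite_Un finite_lessThan finite_subset)
    \<comment> \<open>In the state with all \<open>E j\<close> and \<open>V j\<close> empty the
      restriction on partitions is vacuous, so all partitions into \<open>K + 1\<close> classes get
      killed. Working in \<open>Y \<inter> {s..}\<close> keeps the killing sets above the earlier
      stage \<open>s\<close>.\<close>
    then have "good \<Psi> s {A. (\<forall>x. A x < Suc K) \<and> (\<forall>j<Suc K. \<forall>a\<in>{}. A a = j)}"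
      by (intro good_states[where Y = "Y \<inter> {s..}" and t = 0 and V = "\<lambda>_. {}"] continuous hereditary) auto
    then have "\<exists>c s'. agree s (pair_bit (snd (prod_decode r))) c \<and> (\<forall>c'. agree s' c c' \<longrightarrow>
        (\<forall>A\<in>{A. (\<forall>x. A x < Suc K) \<and> (\<forall>j<Suc K. \<forall>a\<in>{}. A a = j)}. killed \<Psi> s c' A s'))"
      unfolding good_def by (elim allE)
    then obtain c s' where c: "agree s (pair_bit (snd (prod_decode r))) c"
      and kill: "\<forall>c'. agree s' c c' \<longrightarrow> (\<forall>A\<in>{A. \<forall>x. A x < Suc K}. killed \<Psi> s c' A s')"
      by auto
    have "agree s' c c"
      by (simp add: agree_def)
    then have "killed \<Psi> s c A s'" if "\<And>x. A x < Suc K" for A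
      using kill that by blast
    with c show ?thesis
      by (rule ex_extends[OF g \<Psi> _ s_def])
  qed
  define s where "s K = fst (prod_decode (stage g K))" for K
  define w where "w K = snd (prod_decode (stage g K))" for K
  have "extends g K (stage g K) (stage g (Suc K))" for K
    unfolding stage_def by (simp add: LeastI_ex[OF ex])
  then have s_less: "s K < s (Suc K)"
    and w_Suc: "\<And>u v. v < s K \<Longrightarrow> u < v \<Longrightarrow> pair_bit (w K) u v = pair_bit (w (Suc K)) u v"
    and wins: "wins g (Suc K) (s K) (w (Suc K)) (s (Suc K))" for K
    unfolding extends_def s_def w_def by blast+
  have s_mono: "s K \<le> s K'" if "K \<le> K'" for K K'
    using that s_less by (metis lift_Suc_mono_le less_imp_le_nat)
  have s_ge: "K \<le> s K" for K
    by (induction K) (use s_less in \<open>auto intro: Suc_leI le_less_trans\<close>)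
  have w_le: "pair_bit (w K) u v = pair_bit (w K') u v" if "K \<le> K'" "v < s K" "u < v" for K K' u v
    using that(1)
  proof (induction K' rule: dec_induct)
    case base
    then show ?case ..
  next
    case (step K')
    have "v < s K'"
      using s_mono[OF step.hyps(1)] that(2) by simp
    then show ?case
      using step.IH w_Suc that(3) by simp
  qed
  have w_eq: "pair_bit (w K) u v = pair_bit (w K') u v" if "v < s K" "v < s K'" "u < v" for K K' u v
    using w_le[of K K' v u] w_le[of K' K v u] that by (metis nat_le_linear)
  \<comment> \<open>The color of \<open>(u, v)\<close> is read at stage \<open>v + 1\<close>, where
    it is already settled because \<open>s (v + 1) > v\<close>; later stages preserve it.\<close>
  define c :: "nat set \<Rightarrow> nat" where "c S = of_bool (pair_bit (w (Suc (Max S))) (Min S) (Max S))" for S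
  have c: "c {u, v} = of_bool (pair_bit (w K) u v)" if "u < v" "v < s K" for u v K
  proof -
    have "v < s (Suc v)"
      using s_ge[of "Suc v"] by simp
    then show ?thesis
      using w_eq[of v "Suc v" K u] that by (simp add: c_def)
  qed
  have "coloring 2 c"
    by (auto simp: coloring_def c_def)
  moreover have "computable_coloring c"
  proof -
    have "recf 2 (\<lambda>e. of_bool (pair_bit (w (Suc (e 1))) (e 0) (e 1)))"
      unfolding w_def by (intro recf_of_bool recp_pair_bit recf_snd_prod_decode recf_stage[OF g ex] recf_Suc recf_var) simp_all
    then obtain q where q: "\<And>e. run q {} (map e [0..<2]) = Some (of_bool (pair_bit (w (Suc (e 1))) (e 0) (e 1)))"
      unfolding recf_def by blast
    have "run q {} [x, y] = Some (c {x, y})" if "x < y" for x y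
      using q[of "\<lambda>i. if i = 0 then x else y"] that by (simp add: c_def upt_rec numeral_2_eq_2)
    then show ?thesis
      unfolding computable_coloring_def by blast
  qed
  moreover have "\<exists>L. infinite L \<and> limit_homogeneous k d L \<and>
      \<not> (\<exists>H. infinite H \<and> homogeneous c H \<and> \<Psi> L = (\<lambda>n. Some (char_fun H n)))"
    if stable: "stable_coloring k d" for k and d :: "nat set \<Rightarrow> nat"
  proof -
    obtain A where A: "\<And>x. A x < k" "\<And>x. (\<lambda>y. d {x, y}) \<longlonglongrightarrow> A x"
      using stable_coloring_limit[OF stable] by blast
    obtain m where m: "\<And>x. m \<le> x \<Longrightarrow> infinite {y. A y = A x}"
      using finite_color_classes_bounded A(1) by blast
    \<comment> \<open>\<open>K \<ge> k\<close> makes \<open>A\<close> a partition into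
      \<open>K + 1\<close> classes, and \<open>K \<ge> m\<close> places the set \<open>E\<close>,
      whose elements are at least \<open>s K \<ge> K\<close>, above all finite classes.\<close>
    define K where "K = max k m"
    define t where "t = s (Suc K)"
    have "A x < Suc K" for x
      using A(1)[of x] by (simp add: K_def)
    then obtain a where a: "a < Suc K ^ t" "\<forall>i<t. a div Suc K ^ i mod Suc K = A i"
      using ex_digits by blast
    obtain e j u v x y where e: "e < 2 ^ t" "\<forall>i<s K. \<not> odd (e div 2 ^ i)"
        "\<forall>i<t. odd (e div 2 ^ i) \<longrightarrow> a div Suc K ^ i mod Suc K = j"
      and uv: "v < t" "u < v" "y < t" "x < y" "g t e [u] = 2" "g t e [v] = 2" "g t e [x] = 2" "g t e [y] = 2"
        "\<not> (pair_bit (w (Suc K)) u v \<longleftrightarrow> pair_bit (w (Suc K)) x y)"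
      using wins[of K] a(1) unfolding wins_def t_def[symmetric] by blast
    define E where "E = set_decode e"
    have E_t: "E \<subseteq> {..<t}"
      unfolding E_def by (rule set_decode_subset[OF e(1)])
    have E_ge: "m \<le> i" if "i \<in> E" for i
    proof -
      have "\<not> i < s K"
        using e(2) that by (auto simp: E_def set_decode_def)
      then show ?thesis
        using s_ge[of K] by (simp add: K_def)
    qed
    have E_j: "A i = j" if "i \<in> E" for i
      using e(3) a(2) that E_t by (auto simp: E_def set_decode_def)
    \<comment> \<open>If \<open>E\<close> is empty, \<open>j\<close> need not belong to an infinite
      limit color class, and any infinite class is taken instead.\<close>
    obtain j' where j': "j' < k" "infinite {x. A x = j'}" "\<forall>i\<in>E. A i = j'"
    proof (cases "E = {}")
      case True
      then show ?thesis
        using that infinite_color_class A(1) by (metis empty_iff)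
    next
      case False
      then obtain i where "i \<in> E"
        by blast
      then show ?thesis
        using that[of j] A(1)[of i] m[OF E_ge[of i]] E_j by auto
    qed
    \<comment> \<open>The added elements start at \<open>t\<close>, so \<open>L\<close> agrees below
      \<open>t\<close> with the set coded by \<open>e\<close>, and the convergences seen at stage
      \<open>t\<close> hold for \<open>L\<close>.\<close>
    define L where "L = E \<union> {x. t \<le> x \<and> A x = j'}"
    have "{x. A x = j'} \<subseteq> {x. t \<le> x \<and> A x = j'} \<union> {..<t}"
      by auto
    then have "infinite L"
      unfolding L_def using j'(2) by (meson finite_Un finite_lessThan finite_subset)
    moreover have "limit_homogeneous k d L"
    proof -
      have "A x = j'" if "x \<in> L" for x
        using that j'(3) by (auto simp: L_def)
      then show ?thesis
        unfolding limit_homogeneous_def using j'(1) A(2) by blast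
    qed
    moreover have "\<not> (\<exists>H. infinite H \<and> homogeneous c H \<and> \<Psi> L = (\<lambda>n. Some (char_fun H n)))"
    proof
      assume "\<exists>H. infinite H \<and> homogeneous c H \<and> \<Psi> L = (\<lambda>n. Some (char_fun H n))"
      then obtain H where H: "homogeneous c H" "\<Psi> L = (\<lambda>n. Some (char_fun H n))"
        by blast
      have L_t: "L \<inter> {..<t} = set_decode e \<inter> {..<t}"
        by (auto simp: L_def E_def)
      have in_H: "z \<in> H" if "g t e [z] = 2" for z
      proof -
        have "\<Psi> L z = Some 1"
          using approximatesD(1)[OF g _ _ L_t, of "[z]" 1] that by (simp add: \<Psi> numeral_2_eq_2)
        then show ?thesis
          using H(2) by (auto simp: char_fun_def split: if_splits)
      qed
      have "{u, v} \<in> nsets H 2" "{x, y} \<in> nsets H 2"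
        using in_H uv by (auto simp: nsets_def)
      then have "c {u, v} = c {x, y}"
        using H(1) unfolding homogeneous_def by metis
      then show False
        using c[of u v "Suc K"] c[of x y "Suc K"] uv(1-4,9) by (simp add: t_def of_bool_eq_iff)
    qed
    ultimately show ?thesis
      by blast
  qed
  ultimately show ?thesis
    by blast
qed

end
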